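(* Let $E$ be a finite set, let $\nu_1,\nu_2: 2^E \to \mathbb{R}\cup\{-\infty\}$ be two $M^\natural$-concave functions, and let $q$ be a real number with $0<q\leq 1$. For each integer $k$ put $$J_{\nu_1,\nu_2, q;k}:=\sum_{\substack{S_1\subseteq S_2\subseteq E\\ |S_2\setminus S_1|=k} } q^{-\nu_1(S_1)-\nu_2(S_2)}.$$ Then for every integer $k$ with $0\leq k\leq |E|-2$, $$\frac{J_{\nu_1,\nu_2, q;k}}{\binom{|E|}{k}}\cdot \frac{J_{\nu_1,\nu_2, q;k+2}}{\binom{|E|}{k+2}}\leq \left(\frac{J_{\nu_1,\nu_2, q;k+1}}{\binom{|E|}{k+1}}\right)^2.$$
   Context: $2^E$ denotes the set of subsets of $E$. A function $\nu: 2^E \to \mathbb{R}\cup \{-\infty\}$ is called $M^\natural$-concave if for all $I_1,I_2\subseteq E$ and all $i_1 \in I_1\setminus I_2$ at least one of the following holds: (1) $\nu(I_1) + \nu(I_2) \leq \nu(I_1\setminus \{i_1\}) + \nu(I_2 \cup \{i_1\})$; (2) there is $i_2 \in I_2\setminus I_1$ such that $\nu(I_1) + \nu(I_2) \leq \nu((I_1\setminus \{i_1\}) \cup \{i_2\}) + \nu((I_2 \setminus \{i_2\}) \cup \{i_1\})$. Conventions: $-\infty + a = -\infty$ for all $a\in\mathbb{R}\cup\{-\infty\}$, $-\infty\le a$ for all $a$, and $q^{-\nu_1(S_1)-\nu_2(S_2)}=0$ whenever $\nu_1(S_1)=-\infty$ or $\nu_2(S_2)=-\infty$ (for every $0<q\leq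 1$, including $q=1$). *)

theory Defs
  imports Complex_Main "HOL-Library.Extended_Real"
begin

text \<open>Set functions with values in the reals extended by minus infinity are modelled as
  \<^typ>\<open>ereal\<close>-valued functions that avoid \<^term>\<open>\<infinity> :: ereal\<close> on the subsets of \<open>E\<close>; on such values
  the addition and order of \<^typ>\<open>ereal\<close> obey the conventions \<open>-\<infinity> + a = -\<infinity>\<close> and \<open>-\<infinity> \<le> a\<close>.
  Values on sets that are not contained in \<open>E\<close> are irrelevant.\<close>

definition M_natural_concave :: "'a set \<Rightarrow> ('a set \<Rightarrow> ereal) \<Rightarrow> bool" where
  "M_natural_concave E \<nu> \<longleftrightarrow>
     (\<forall>S. S \<subseteq> E \<longrightarrow> \<nu> S \<noteq> \<infinity>) \<and>
     (\<forall>I1 I2. I1 \<subseteq> E \<longrightarrow> I2 \<subseteq> E \<longrightarrow> (\<forall>i1 \<in> I1 - I2.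
        \<nu> I1 + \<nu> I2 \<le> \<nu> (I1 - {i1}) + \<nu> (I2 \<union> {i1}) \<or>
        (\<exists>i2 \<in> I2 - I1.
           \<nu> I1 + \<nu> I2 \<le> \<nu> ((I1 - {i1}) \<union> {i2}) + \<nu> ((I2 - {i2}) \<union> {i1}))))"

text \<open>The term \<open>q\<^bsup>-x-y\<^esup>\<close>, read as \<open>0\<close> if \<open>x\<close> or \<open>y\<close> is \<open>-\<infinity>\<close>, also for \<open>q = 1\<close>.
  Only used for \<open>x, y \<noteq> \<infinity>\<close>, where \<^const>\<open>real_of_ereal\<close> is the plain projection.\<close>

definition q_weight :: "real \<Rightarrow> ereal \<Rightarrow> ereal \<Rightarrow> real" where
  "q_weight q x y =
     (if x = -\<infinity> \<or> y = -\<infinity> then 0 else q powr (- real_of_ereal x - real_of_ereal y))"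

definition J :: "'a set \<Rightarrow> ('a set \<Rightarrow> ereal) \<Rightarrow> ('a set \<Rightarrow> ereal) \<Rightarrow> real \<Rightarrow> nat \<Rightarrow> real" where
  "J E \<nu>1 \<nu>2 q k =
     (\<Sum>(S1, S2) \<in> {(S1, S2). S1 \<subseteq> S2 \<and> S2 \<subseteq> E \<and> card (S2 - S1) = k}.
        q_weight q (\<nu>1 S1) (\<nu>2 S2))"

end

(* Put a_i(S) = q^(-nu_i(S)), so that M-natural-concavity becomes a multiplicative exchange property
   of a_i. On two disjoint copies of E, mu(S + T) = a_2(S) * a_1(E - T) has this property again, and
   the key point is that for every such mu on an n-element set N the homogeneous polynomial
   sum_S mu(S) w^S y^(n - |S|), without factorials, is Lorentzian: all its iterated nonnegative
   directional derivatives of degree two have at most one positive eigenvalue. By the local-to-global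
   principle for Lorentzian polynomials this only has to be checked for partial derivatives, where
   it follows from an inequality for ultrametric matrices.
   With n = 2|E|, differentiating once for each e in E in the direction in which both copies of w_e
   move together leaves the terms in which S contains A := E - T, weighted by a_1(A) a_2(S). The
   result is a polynomial of degree |E|, and letting the first copies of all the w_e be equal to x
   turns it into sum_k J_k x^k y^(|E| - k). The discriminants of the quadratic
   derivatives of this binary form are the claimed inequalities. *)
theory Submission
  imports Defs "HOL-Analysis.Function_Topology" "HOL-Library.Multiset"
begin

section \<open>Quadratic forms with one positive eigenvalue\<close>

text \<open>The missing factorials carry the binomials of the claim: with y^(n - |S|) divided by (n
  - |S|)! the same argument would give only log-concavity of k! J_k, which is weaker. The price is
  paid in the quadratic forms. If r of the variables w_i are left, the Hessian entries at y y, y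
  w_i, w_i w_j are proportional to r (r - 1) b {}, (r - 1) b {i}, b {i, j}. Dividing b {i, j} by b
  {i} b {j} turns the exchange property into an ultrametric inequality, and the constant 1 - 1/r in
  the resulting estimate, which is attained by constant matrices, is just small enough. The
  local-to-global step is a Perron-Frobenius argument. It needs a simple top eigenvalue, hence
  connectedness of the positive entries of the Hessian. For strictly positive directions these
  entries depend only on the support of the polynomial, so connectedness becomes a combinatorial
  statement about exchange; general nonnegative directions follow by a limit.\<close>

definition bil :: "'i set \<Rightarrow> ('i \<Rightarrow> 'i \<Rightarrow> real) \<Rightarrow> ('i \<Rightarrow> real) \<Rightarrow> ('i \<Rightarrow> real) \<Rightarrow> real" where
  "bil I M x y = (\<Sum>i\<in>I. \<Sum>j\<in>I. x i * M i j * y j)"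

text \<open>For symmetric \<open>M\<close> with nonnegative entries this says that \<open>M\<close> has at most one positive
  eigenvalue; stated in this way it is visibly closed under limits.\<close>

definition lorentz_form :: "'i set \<Rightarrow> ('i \<Rightarrow> 'i \<Rightarrow> real) \<Rightarrow> bool" where
  "lorentz_form I M \<longleftrightarrow> (\<forall>x p. (\<forall>i\<in>I. 0 \<le> p i) \<longrightarrow> bil I M x x * bil I M p p \<le> (bil I M x p)\<^sup>2)"

lemma bil_cong:
  assumes "\<And>i j. i \<in> I \<Longrightarrow> j \<in> I \<Longrightarrow> M i j = M' i j"
    and "\<And>i. i \<in> I \<Longrightarrow> x i = x' i" and "\<And>i. i \<in> I \<Longrightarrow> y i = y' i"
  shows "bil I M x y = bil I M' x' y'"
  unfolding bil_def using assms by (auto intro!: sum.cong)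

lemma lorentz_form_cong:
  assumes "\<And>i j. i \<in> I \<Longrightarrow> j \<in> I \<Longrightarrow> M i j = M' i j"
  shows "lorentz_form I M \<longleftrightarrow> lorentz_form I M'"
proof -
  have "bil I M x y = bil I M' x y" for x y
    using assms by (intro bil_cong) auto
  then show ?thesis by (simp add: lorentz_form_def)
qed

lemma bil_sym:
  assumes "\<And>i j. i \<in> I \<Longrightarrow> j \<in> I \<Longrightarrow> M i j = M j i"
  shows "bil I M x y = bil I M y x"
proof -
  have "bil I M x y = (\<Sum>j\<in>I. \<Sum>i\<in>I. x i * M i j * y j)"
    unfolding bil_def by (rule sum.swap)
  also have "\<dots> = bil I M y x"
    unfolding bil_def using assms by (intro sum.cong refl) (simp add: mult_ac)
  finally show ?thesis .
qed

lemma bil_add_left: "bil I M (\<lambda>i. x i + s * y i) z = bil I M x z + s * bil I M y z"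
  unfolding bil_def by (simp add: sum_distrib_left sum.distrib algebra_simps)

lemma bil_add_right: "bil I M z (\<lambda>i. x i + s * y i) = bil I M z x + s * bil I M z y"
  unfolding bil_def by (simp add: sum_distrib_left sum.distrib algebra_simps)

lemma bil_add_scaled:
  assumes "\<And>i j. i \<in> I \<Longrightarrow> j \<in> I \<Longrightarrow> M i j = M j i"
  shows "bil I M (\<lambda>i. x i + s * y i) (\<lambda>i. x i + s * y i) =
    bil I M x x + 2 * s * bil I M x y + s\<^sup>2 * bil I M y y"
  using bil_sym[of I M x y] assms
  by (simp add: bil_add_left bil_add_right power2_eq_square algebra_simps)

lemma bil_nonneg:
  assumes "\<And>i j. i \<in> I \<Longrightarrow> j \<in> I \<Longrightarrow> 0 \<le> M i j" and "\<And>i. i \<in> I \<Longrightarrow> 0 \<le> p i"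
  shows "0 \<le> bil I M p p"
  unfolding bil_def using assms by (intro sum_nonneg) auto

text \<open>If \<open>p\<close> has positive form value, then \<open>p\<close> is not in the
  hyperplane \<open>l = 0\<close>, where the form is nonpositive. Moving \<open>x\<close> along
  \<open>p\<close> into the hyperplane and completing the square gives the reversed Cauchy-Schwarz
  inequality. If the value at \<open>p\<close> is \<open>0\<close>, the left side vanishes.\<close>

lemma lorentz_formI:
  assumes sym: "\<And>i j. i \<in> I \<Longrightarrow> j \<in> I \<Longrightarrow> M i j = M j i"
    and nonneg: "\<And>i j. i \<in> I \<Longrightarrow> j \<in> I \<Longrightarrow> 0 \<le> M i j"
    and neg: "\<And>x. (\<Sum>i\<in>I. l i * x i) = 0 \<Longrightarrow> bil I M x x \<le> 0"
  shows "lorentz_form I M"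
  unfolding lorentz_form_def
proof (intro allI impI)
  fix x p :: "'a \<Rightarrow> real"
  assume p: "\<forall>i\<in>I. 0 \<le> p i"
  let ?l = "\<lambda>x. \<Sum>i\<in>I. l i * x i"
  show "bil I M x x * bil I M p p \<le> (bil I M x p)\<^sup>2"
  proof (cases "bil I M p p = 0")
    case False
    with bil_nonneg[of I M p] nonneg p have pos: "0 < bil I M p p" by force
    then have lp: "?l p \<noteq> 0" using neg[of p] by fastforce
    define s where "s = - (?l x / ?l p)"
    have "?l (\<lambda>i. x i + s * p i) = ?l x + s * ?l p"
      by (simp add: sum.distrib sum_distrib_left algebra_simps)
    then have "?l (\<lambda>i. x i + s * p i) = 0" using lp by (simp add: s_def)
    from neg[OF this] have h: "bil I M x x + 2 * s * bil I M x p + s\<^sup>2 * bil I M p p \<le> 0"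
      using bil_add_scaled[of I M x s p] sym by simp
    have "0 \<le> (bil I M x p + s * bil I M p p)\<^sup>2" by simp
    also have "\<dots> = (bil I M x p)\<^sup>2 - bil I M x x * bil I M p p
        + bil I M p p * (bil I M x x + 2 * s * bil I M x p + s\<^sup>2 * bil I M p p)"
      by (simp add: power2_eq_square algebra_simps)
    also have "\<dots> \<le> (bil I M x p)\<^sup>2 - bil I M x x * bil I M p p"
      using mult_nonneg_nonpos[OF less_imp_le[OF pos] h] by linarith
    finally show ?thesis by simp
  qed simp
qed

lemma bil_mono_neutral:
  assumes "finite I" "I' \<subseteq> I"
    and "\<And>i j. i \<in> I \<Longrightarrow> j \<in> I \<Longrightarrow> i \<notin> I' \<or> j \<notin> I' \<Longrightarrow> M i j = 0"
  shows "bil I M x y = bil I' M x y"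
proof -
  have "bil I M x y = (\<Sum>i\<in>I'. \<Sum>j\<in>I. x i * M i j * y j)"
    unfolding bil_def using assms by (intro sum.mono_neutral_right) auto
  also have "\<dots> = bil I' M x y"
    unfolding bil_def using assms by (intro sum.cong refl sum.mono_neutral_right) auto
  finally show ?thesis .
qed

lemma lorentz_form_mono_neutral:
  assumes "finite I" "I' \<subseteq> I"
    and zero: "\<And>i j. i \<in> I \<Longrightarrow> j \<in> I \<Longrightarrow> i \<notin> I' \<or> j \<notin> I' \<Longrightarrow> M i j = 0"
  shows "lorentz_form I M \<longleftrightarrow> lorentz_form I' M"
proof -
  have *: "bil I M x y = bil I' M x y" for x y
    using assms by (rule bil_mono_neutral)
  show ?thesis
  proof
    assume L: "lorentz_form I M"
    show "lorentz_form I' M"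
      unfolding lorentz_form_def
    proof (intro allI impI)
      fix x p :: "'a \<Rightarrow> real" assume p: "\<forall>i\<in>I'. 0 \<le> p i"
      \<comment> \<open>Nonnegativity of \<open>p\<close> is known only on \<open>I'\<close>;
        extension by zero makes it an admissible vector on \<open>I\<close>.\<close>
      let ?p = "\<lambda>i. if i \<in> I' then p i else 0"
      have "bil I M x x * bil I M ?p ?p \<le> (bil I M x ?p)\<^sup>2"
        using L p unfolding lorentz_form_def by auto
      moreover have "bil I' M x ?p = bil I' M x p" "bil I' M ?p ?p = bil I' M p p"
        by (auto intro!: bil_cong)
      ultimately show "bil I' M x x * bil I' M p p \<le> (bil I' M x p)\<^sup>2"
        by (simp add: *)
    qed
  next
    assume "lorentz_form I' M"
    then show "lorentz_form I M"
      unfolding lorentz_form_def * using assms(2) by blast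
  qed
qed

section \<open>An inequality for ultrametric matrices\<close>

text \<open>For a constant matrix the left side is \<open>B\<close> times the square of the sum
  minus the sum of squares, and Cauchy-Schwarz gives the constant \<open>1 - 1 / card N\<close>. An
  ultrametric matrix reduces to this by splitting off blocks between which its entries take their
  maximal value.\<close>

lemma ultrametric_form_le:
  fixes b :: "'i \<Rightarrow> 'i \<Rightarrow> real" and B :: real
  assumes "finite N" "\<And>i j. i \<in> N \<Longrightarrow> j \<in> N \<Longrightarrow> b i j = b j i"
    and "\<And>i j. i \<in> N \<Longrightarrow> j \<in> N \<Longrightarrow> i \<noteq> j \<Longrightarrow> b i j \<le> B" and "0 \<le> B"
    and "\<And>i j k. i \<in> N \<Longrightarrow> j \<in> N \<Longrightarrow> k \<in> N \<Longrightarrow> i \<noteq> j \<Longrightarrow> i \<noteq> k \<Longrightarrow> j \<noteq> k \<Longrightarrow>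
        b i j \<le> max (b i k) (b j k)"
    and nn: "\<And>i j. i \<in> N \<Longrightarrow> j \<in> N \<Longrightarrow> 0 \<le> b i j"
  shows "(\<Sum>i\<in>N. \<Sum>j\<in>N - {i}. b i j * x i * x j) \<le> B * (1 - 1 / real (card N)) * (\<Sum>i\<in>N. x i)\<^sup>2"
  using assms
proof (induction "card N" arbitrary: N B rule: less_induct)
  case less
  let ?Q = "\<lambda>N. \<Sum>i\<in>N. \<Sum>j\<in>N - {i}. b i j * x i * x j"
  note fin = \<open>finite N\<close>
  show ?case
  proof (cases "\<exists>i\<in>N. \<exists>j\<in>N. i \<noteq> j")
    case False
    then have "j \<notin> N - {i}" if "i \<in> N" for i j using that by auto
    then have "?Q N = 0" by (intro sum.neutral ballI) metis
    moreover have "card N \<le> 1" using False fin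
      by (metis card_le_Suc0_iff_eq One_nat_def)
    \<comment> \<open>For empty \<open>N\<close> the convention \<open>1 / 0 = 0\<close> makes this
      factor \<open>1\<close>; for a singleton it is \<open>0\<close>.\<close>
    then have "0 \<le> 1 - 1 / real (card N)" 
      by (cases "card N = 0") auto
    ultimately show ?thesis using \<open>0 \<le> B\<close> by simp
  next
    case True
    define V where "V = (\<lambda>(i, j). b i j) ` {(i, j). i \<in> N \<and> j \<in> N \<and> i \<noteq> j}"
    have "finite {(i, j). i \<in> N \<and> j \<in> N \<and> i \<noteq> j}"
      by (rule finite_subset[of _ "N \<times> N"]) (use fin in auto)
    then have finV: "finite V" by (simp add: V_def)
    have "V \<noteq> {}" using True by (auto simp: V_def)
    define M where "M = Max V"
    from Max_in[OF finV \<open>V \<noteq> {}\<close>] obtain i0 j0 where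
      ij: "i0 \<in> N" "j0 \<in> N" "i0 \<noteq> j0" "b i0 j0 = M" by (auto simp: V_def M_def)
    have bM: "b i j \<le> M" if "i \<in> N" "j \<in> N" "i \<noteq> j" for i j
      unfolding M_def using that by (intro Max_ge finV) (auto simp: V_def)
    have M0: "0 \<le> M" using ij less.prems(6) by metis
    have MB: "M \<le> B" using ij less.prems(3) by metis
    \<comment> \<open>All entries between \<open>C\<close> and its complement equal the maximum \<open>M\<close>, which allows an
      induction over the two blocks.\<close>
    define C where "C = {k \<in> N. k = i0 \<or> b i0 k < M}"
    define R where "R = N - C"
    have CN: "C \<subseteq> N" "R \<subseteq> N" "C \<inter> R = {}" "C \<union> R = N" by (auto simp: C_def R_def)
    have iC: "i0 \<in> C" and jR: "j0 \<in> R" using ij by (auto simp: C_def R_def)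
    have finCR: "finite C" "finite R" using CN fin finite_subset by auto
    have cC: "card C < card N" using jR CN ij(2) fin by (intro psubset_card_mono) (auto simp: R_def)
    have cR: "card R < card N" using iC CN ij(1) fin by (intro psubset_card_mono) auto
    have cross: "b k l = M" if "k \<in> C" "l \<in> R" for k l
    proof -
      have kl: "k \<in> N" "l \<in> N" "k \<noteq> l" using that CN by auto
      have il: "b i0 l = M" "l \<noteq> i0" using that bM[of i0 l] ij(1) by (auto simp: C_def R_def)
      show ?thesis
      proof (cases "k = i0")
        case True then show ?thesis using il by simp
      next
        case False
        then have "b i0 k < M" using that by (auto simp: C_def)
        moreover have "b i0 l \<le> max (b i0 k) (b l k)"
          using less.prems(5)[of i0 l k] ij kl il False by auto
        ultimately have "M \<le> b l k" using il by auto
        then show ?thesis using bM[of k l] kl less.prems(2)[of k l] by auto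
      qed
    qed
    have sub: "?Q N' \<le> M * (1 - 1 / real (card N')) * (\<Sum>i\<in>N'. x i)\<^sup>2"
      if N': "N' \<subseteq> N" "card N' < card N" for N'
    proof (rule less.hyps[OF N'(2)])
      show "finite N'" using N' fin finite_subset by blast
      show "b i j = b j i" if "i \<in> N'" "j \<in> N'" for i j
        using that N' by (intro less.prems(2)) auto
      show "b i j \<le> M" if "i \<in> N'" "j \<in> N'" "i \<noteq> j" for i j
        using that N' by (intro bM) auto
      show "b i j \<le> max (b i k) (b j k)"
        if "i \<in> N'" "j \<in> N'" "k \<in> N'" "i \<noteq> j" "i \<noteq> k" "j \<noteq> k" for i j k
        using that N' by (intro less.prems(5)) auto
      show "0 \<le> b i j" if "i \<in> N'" "j \<in> N'" for i j
        using that N' by (intro less.prems(6)) auto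
    qed (rule M0)
    note IC = sub[OF CN(1) cC] and IR = sub[OF CN(2) cR]
    let ?c = "\<Sum>i\<in>C. x i" and ?r = "\<Sum>i\<in>R. x i"
    have split: "sum f N = sum f C + sum f R" for f :: "'i \<Rightarrow> real"
      using sum.union_disjoint[of C R f] CN finCR by simp
    note sN = split[of x]
    have rowC: "(\<Sum>j\<in>N - {i}. b i j * x i * x j) = (\<Sum>j\<in>C - {i}. b i j * x i * x j) + M * x i * ?r"
      if "i \<in> C" for i
    proof -
      have "N - {i} = (C - {i}) \<union> R" using CN that by auto
      then have "(\<Sum>j\<in>N - {i}. b i j * x i * x j) =
          (\<Sum>j\<in>C - {i}. b i j * x i * x j) + (\<Sum>j\<in>R. b i j * x i * x j)"
        using sum.union_disjoint[of "C - {i}" R] CN finCR by force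
      also have "(\<Sum>j\<in>R. b i j * x i * x j) = M * x i * ?r"
        using cross that by (simp add: sum_distrib_left)
      finally show ?thesis .
    qed
    have rowR: "(\<Sum>j\<in>N - {i}. b i j * x i * x j) = (\<Sum>j\<in>R - {i}. b i j * x i * x j) + M * x i * ?c"
      if "i \<in> R" for i
    proof -
      have "N - {i} = (R - {i}) \<union> C" using CN that by auto
      then have "(\<Sum>j\<in>N - {i}. b i j * x i * x j) =
          (\<Sum>j\<in>R - {i}. b i j * x i * x j) + (\<Sum>j\<in>C. b i j * x i * x j)"
        using sum.union_disjoint[of "R - {i}" C] CN finCR by force
      also have "(\<Sum>j\<in>C. b i j * x i * x j) = M * x i * ?c"
        using cross that less.prems(2)[of i] CN by (auto simp: sum_distrib_left subset_iff intro!: sum.cong)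
      finally show ?thesis .
    qed
    have "?Q N = (\<Sum>i\<in>C. \<Sum>j\<in>N - {i}. b i j * x i * x j) + (\<Sum>i\<in>R. \<Sum>j\<in>N - {i}. b i j * x i * x j)"
      by (rule split)
    also have "\<dots> = ?Q C + ?Q R + 2 * M * ?c * ?r"
      by (simp add: rowC rowR sum.distrib sum_distrib_left[symmetric] sum_distrib_right[symmetric])
    also have "\<dots> \<le> M * ((?c + ?r)\<^sup>2 - (?c\<^sup>2 / card C + ?r\<^sup>2 / card R))"
      using IC IR by (simp add: power2_eq_square algebra_simps)
    also have "\<dots> \<le> M * ((?c + ?r)\<^sup>2 - (?c + ?r)\<^sup>2 / card N)"
    proof -
      have card: "card N = card C + card R"
        using card_Un_disjoint[of C R] CN finCR by auto
      have pos: "0 < real (card C)" "0 < real (card R)"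
        using iC jR finCR by (auto simp: card_gt_0_iff)
      \<comment> \<open>Cauchy-Schwarz for two terms: this is how the constants of the two blocks
        merge into the one for \<open>N\<close>.\<close>
      have "(?c + ?r)\<^sup>2 / (real (card C) + real (card R)) \<le> ?c\<^sup>2 / card C + ?r\<^sup>2 / card R"
      proof -
        have "?c\<^sup>2 / card C + ?r\<^sup>2 / card R - (?c + ?r)\<^sup>2 / (real (card C) + real (card R))
          = (card R * ?c - card C * ?r)\<^sup>2 / (card C * card R * (real (card C) + real (card R)))"
          using pos by (simp add: divide_simps power2_eq_square) (simp add: algebra_simps)
        also have "\<dots> \<ge> 0" using pos by simp
        finally show ?thesis by simp
      qed
      then show ?thesis using M0 by (intro mult_left_mono) (simp_all add: card)
    qed
    also have "\<dots> = M * ((1 - 1 / real (card N)) * (\<Sum>i\<in>N. x i)\<^sup>2)"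
      by (simp add: sN algebra_simps)
    also have "\<dots> \<le> B * ((1 - 1 / real (card N)) * (\<Sum>i\<in>N. x i)\<^sup>2)"
    proof -
      have "card N \<ge> 1" using cC by linarith
      then show ?thesis using MB by (intro mult_right_mono) auto
    qed
    finally show ?thesis by (simp add: mult.assoc)
  qed
qed

section \<open>The local-to-global principle\<close>

lemma bil_row: "bil I M x y = (\<Sum>i\<in>I. x i * (\<Sum>j\<in>I. M i j * y j))"
  by (simp add: bil_def sum_distrib_left mult.assoc)

text \<open>Ground state substitution: with \<open>x = v * (x / v)\<close>, the matrix
  \<open>diag (M v / v) - M\<close> becomes a weighted graph Laplacian in \<open>x / v\<close>. For
  nonnegative \<open>M\<close> its form can vanish only if \<open>x / v\<close> agrees at any two
  indices joined by a positive entry.\<close>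

lemma perron_identity:
  fixes v :: "'i \<Rightarrow> real"
  assumes "finite I" and sym: "\<And>i j. i \<in> I \<Longrightarrow> j \<in> I \<Longrightarrow> M i j = M j i"
    and v: "\<And>i. i \<in> I \<Longrightarrow> 0 < v i"
  shows "(\<Sum>i\<in>I. \<Sum>j\<in>I. M i j * v i * v j * (x i / v i - x j / v j)\<^sup>2) =
    2 * ((\<Sum>i\<in>I. (\<Sum>j\<in>I. M i j * v j) / v i * (x i)\<^sup>2) - bil I M x x)"
proof -
  have "M i j * v i * v j * (x i / v i - x j / v j)\<^sup>2 =
      M i j * v j / v i * (x i)\<^sup>2 + M i j * v i / v j * (x j)\<^sup>2 - 2 * (x i * M i j * x j)"
    if "i \<in> I" "j \<in> I" for i j
    using v[OF that(1)] v[OF that(2)]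
    by (simp add: divide_simps power2_eq_square) (simp add: algebra_simps)
  then have "(\<Sum>i\<in>I. \<Sum>j\<in>I. M i j * v i * v j * (x i / v i - x j / v j)\<^sup>2) =
      (\<Sum>i\<in>I. \<Sum>j\<in>I. M i j * v j / v i * (x i)\<^sup>2 + M i j * v i / v j * (x j)\<^sup>2 - 2 * (x i * M i j * x j))"
    by (intro sum.cong refl) simp
  also have "\<dots> = (\<Sum>i\<in>I. \<Sum>j\<in>I. M i j * v j / v i * (x i)\<^sup>2)
      + (\<Sum>i\<in>I. \<Sum>j\<in>I. M i j * v i / v j * (x j)\<^sup>2) - 2 * bil I M x x"
    by (simp add: bil_def sum.distrib sum_subtractf sum_distrib_left)
  also have "(\<Sum>i\<in>I. \<Sum>j\<in>I. M i j * v i / v j * (x j)\<^sup>2) = (\<Sum>j\<in>I. \<Sum>i\<in>I. M i j * v i / v j * (x j)\<^sup>2)"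
    by (rule sum.swap)
  also have "\<dots> = (\<Sum>i\<in>I. \<Sum>j\<in>I. M i j * v j / v i * (x i)\<^sup>2)"
    using sym by (intro sum.cong refl) simp
  also have "(\<Sum>i\<in>I. \<Sum>j\<in>I. M i j * v j / v i * (x i)\<^sup>2) = (\<Sum>i\<in>I. (\<Sum>j\<in>I. M i j * v j) / v i * (x i)\<^sup>2)"
    by (simp add: sum_distrib_right sum_divide_distrib)
  finally show ?thesis by simp
qed

text \<open>Vectors are total functions on a possibly infinite index type, so compactness is
  Tychonoff's theorem in the product topology.\<close>

lemma compact_box_fun: "compact {x :: 'i \<Rightarrow> real. \<forall>i. x i \<in> {- C i..C i}}"
proof -
  have "compactin (product_topology (\<lambda>i. euclidean) UNIV) (PiE UNIV (\<lambda>i. {- C i..C i}))"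
    by (subst compactin_PiE) auto
  then show ?thesis
    by (simp add: euclidean_product_topology PiE_def Pi_def)
qed

lemma continuous_on_coord: "continuous_on S (\<lambda>x. x i :: real)"
  by (rule continuous_on_subset[OF continuous_on_product_coordinates]) simp

lemma sphere_form_attains_max:
  fixes \<rho> w :: "'i \<Rightarrow> real"
  assumes "finite I" and \<rho>: "\<And>i. i \<in> I \<Longrightarrow> 0 < \<rho> i"
    and K: "K = {x. (\<forall>i. i \<notin> I \<longrightarrow> x i = 0) \<and> (\<Sum>i\<in>I. \<rho> i * (x i)\<^sup>2) = 1 \<and> (\<Sum>i\<in>I. w i * x i) = 0}"
    and "K \<noteq> {}"
  obtains x where "x \<in> K" "\<And>y. y \<in> K \<Longrightarrow> bil I M y y \<le> bil I M x x"
proof -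
  \<comment> \<open>Any bound for the coordinates will do; \<open>1 + 1 / \<rho> i\<close> avoids
    square roots through \<open>\<bar>t\<bar> \<le> 1 + t * t\<close>. Off \<open>I\<close> the box
    is a single point.\<close>
  define C where "C i = (if i \<in> I then 1 + 1 / \<rho> i else 0)" for i
  define Box where "Box = {x :: 'i \<Rightarrow> real. \<forall>i. x i \<in> {- C i..C i}}"
  have "K \<subseteq> Box"
  proof
    fix x assume x: "x \<in> K"
    have "\<bar>x i\<bar> \<le> C i" for i
    proof (cases "i \<in> I")
      case True
      have "\<rho> i * (x i)\<^sup>2 \<le> (\<Sum>i\<in>I. \<rho> i * (x i)\<^sup>2)"
        using True \<open>finite I\<close> \<rho> by (intro member_le_sum) (auto simp: less_imp_le)
      then have "(x i)\<^sup>2 \<le> 1 / \<rho> i" using x \<rho>[OF True] by (simp add: K field_simps)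
      moreover have "\<bar>x i\<bar> \<le> 1 + (x i)\<^sup>2"
      proof -
        have "0 \<le> (\<bar>x i\<bar> - 1)\<^sup>2" by simp
        then have "2 * \<bar>x i\<bar> \<le> 1 + (x i)\<^sup>2" by (simp add: power2_eq_square algebra_simps)
        then show ?thesis by linarith
      qed
      ultimately show ?thesis using True by (simp add: C_def)
    next
      case False then show ?thesis using x by (simp add: C_def K)
    qed
    then show "x \<in> Box" by (auto simp: Box_def abs_le_iff minus_le_iff)
  qed
  have "K = Box \<inter> ((\<Inter>i\<in>-I. {x. x i = 0}) \<inter> {x. (\<Sum>i\<in>I. \<rho> i * (x i)\<^sup>2) = 1} \<inter> {x. (\<Sum>i\<in>I. w i * x i) = 0})"
    using \<open>K \<subseteq> Box\<close> by (auto simp: K)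
  moreover have "closed ((\<Inter>i\<in>-I. {x :: 'i \<Rightarrow> real. x i = 0}) \<inter> {x. (\<Sum>i\<in>I. \<rho> i * (x i)\<^sup>2) = 1} \<inter> {x. (\<Sum>i\<in>I. w i * x i) = 0})"
    by (intro closed_Int closed_INT ballI closed_Collect_eq continuous_intros continuous_on_coord)
  moreover have "compact Box" unfolding Box_def by (rule compact_box_fun)
  ultimately have "compact K" by (simp only: compact_Int_closed)
  moreover have "continuous_on K (\<lambda>x. bil I M x x)"
    unfolding bil_def by (intro continuous_intros continuous_on_coord)
  ultimately obtain x where "x \<in> K" "\<forall>y\<in>K. bil I M y y \<le> bil I M x x"
    using continuous_attains_sup[of K "\<lambda>x. bil I M x x"] \<open>K \<noteq> {}\<close> by blast
  then show ?thesis by (intro that) auto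
qed

text \<open>First-order condition at a maximum: for \<open>t\<close> a small enough multiple of
  \<open>a\<close>, the linear term dominates the quadratic one.\<close>

lemma linear_coeff_zero:
  fixes a b :: real
  assumes "\<And>t. 2 * t * a + t\<^sup>2 * b \<le> 0"
  shows "a = 0"
proof (rule ccontr)
  assume "a \<noteq> 0"
  define c where "c = \<bar>b\<bar> + 1"
  have c: "c > 0" "\<bar>b\<bar> < c" by (auto simp: c_def)
  have "2 * (a / c) * a + (a / c)\<^sup>2 * b = a\<^sup>2 / c\<^sup>2 * (2 * c + b)"
    using c by (simp add: power2_eq_square field_simps)
  moreover have "a\<^sup>2 / c\<^sup>2 * (2 * c + b) > 0"
    using c \<open>a \<noteq> 0\<close> by (intro mult_pos_pos) (auto simp: abs_less_iff)
  ultimately show False using assms[of "a / c"] by linarith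
qed

text \<open>\<open>T\<close> plays the third derivative of a polynomial, \<open>M\<close> the
  Hessian of its derivative in direction \<open>v\<close>. Connectedness of the graph of positive
  entries of \<open>M\<close> is stated without paths, in \<open>conn\<close>: a function that is
  constant along edges is constant.\<close>

lemma lorentz_form_sum_pos:
  fixes T :: "'i \<Rightarrow> 'i \<Rightarrow> 'i \<Rightarrow> real" and v :: "'i \<Rightarrow> real"
  assumes fin: "finite I"
    and sym: "\<And>i j k. i \<in> I \<Longrightarrow> j \<in> I \<Longrightarrow> k \<in> I \<Longrightarrow> T i j k = T j i k"
    and sym': "\<And>i j k. i \<in> I \<Longrightarrow> j \<in> I \<Longrightarrow> k \<in> I \<Longrightarrow> T i j k = T i k j"
    and nonneg: "\<And>i j k. i \<in> I \<Longrightarrow> j \<in> I \<Longrightarrow> k \<in> I \<Longrightarrow> 0 \<le> T i j k"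
    and v: "\<And>i. i \<in> I \<Longrightarrow> 0 < v i"
    and lor: "\<And>i. i \<in> I \<Longrightarrow> lorentz_form I (T i)"
    and M: "\<And>j k. M j k = (\<Sum>i\<in>I. v i * T i j k)"
    and w: "\<And>j. w j = (\<Sum>k\<in>I. M j k * v k)" and wpos: "\<And>j. j \<in> I \<Longrightarrow> 0 < w j"
    and conn: "\<And>z j k. (\<And>j k. j \<in> I \<Longrightarrow> k \<in> I \<Longrightarrow> 0 < M j k \<Longrightarrow> z j = (z k :: real)) \<Longrightarrow>
        j \<in> I \<Longrightarrow> k \<in> I \<Longrightarrow> z j = z k"
  shows "lorentz_form I M"
proof -
  have Msym: "M j k = M k j" if "j \<in> I" "k \<in> I" for j k
    unfolding M using that sym' by (intro sum.cong refl) simp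
  have Mnn: "0 \<le> M j k" if "j \<in> I" "k \<in> I" for j k
    unfolding M using that nonneg v by (intro sum_nonneg mult_nonneg_nonneg) (auto simp: less_imp_le)
  have row: "(\<Sum>j\<in>I. \<Sum>k\<in>I. v j * T i j k * x k) = (\<Sum>k\<in>I. M i k * x k)" if "i \<in> I" for i x
  proof -
    have "(\<Sum>j\<in>I. \<Sum>k\<in>I. v j * T i j k * x k) = (\<Sum>k\<in>I. \<Sum>j\<in>I. v j * T i j k * x k)"
      by (rule sum.swap)
    also have "\<dots> = (\<Sum>k\<in>I. M i k * x k)"
      unfolding M sum_distrib_right using that sym by (intro sum.cong refl) simp
    finally show ?thesis .
  qed
  \<comment> \<open>By symmetry of \<open>T\<close>, inserting \<open>v\<close> into
    \<open>T i\<close> gives row \<open>i\<close> of \<open>M\<close>, so the hypothesis on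
    \<open>T i\<close> with \<open>p = v\<close> bounds its form at \<open>x\<close> by
    \<open>(M x) i\<close> squared over \<open>w i\<close>. Summing with weights \<open>v i\<close>
    turns the left side into \<open>M\<close>.\<close>
  have key: "bil I M x x \<le> (\<Sum>i\<in>I. v i / w i * (\<Sum>k\<in>I. M i k * x k)\<^sup>2)" for x
  proof -
    have "bil I M x x = (\<Sum>j\<in>I. \<Sum>k\<in>I. \<Sum>i\<in>I. v i * (x j * T i j k * x k))"
      unfolding bil_def M by (simp add: sum_distrib_left sum_distrib_right mult_ac)
    also have "\<dots> = (\<Sum>j\<in>I. \<Sum>i\<in>I. \<Sum>k\<in>I. v i * (x j * T i j k * x k))"
      by (intro sum.cong refl sum.swap)
    also have "\<dots> = (\<Sum>i\<in>I. \<Sum>j\<in>I. \<Sum>k\<in>I. v i * (x j * T i j k * x k))"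
      by (rule sum.swap)
    also have "\<dots> = (\<Sum>i\<in>I. v i * bil I (T i) x x)"
      by (simp add: bil_def sum_distrib_left)
    also have "\<dots> \<le> (\<Sum>i\<in>I. v i / w i * (\<Sum>k\<in>I. M i k * x k)\<^sup>2)"
    proof (rule sum_mono)
      fix i assume i: "i \<in> I"
      have "bil I (T i) x x * bil I (T i) v v \<le> (bil I (T i) x v)\<^sup>2"
        using lor[OF i] v less_imp_le unfolding lorentz_form_def by blast
      also have "bil I (T i) x v = bil I (T i) v x"
        using i sym' by (intro bil_sym) auto
      also have "\<dots> = (\<Sum>k\<in>I. M i k * x k)" by (simp add: bil_def row[OF i])
      also have "bil I (T i) v v = w i" by (simp add: bil_def row[OF i] w)
      finally have "bil I (T i) x x \<le> (\<Sum>k\<in>I. M i k * x k)\<^sup>2 / w i"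
        using wpos[OF i] by (simp add: field_simps)
      from mult_left_mono[OF this less_imp_le[OF v[OF i]]]
      show "v i * bil I (T i) x x \<le> v i / w i * (\<Sum>k\<in>I. M i k * x k)\<^sup>2" by simp
    qed
    finally show ?thesis .
  qed
  \<comment> \<open>For the weights \<open>w i / v i\<close> the operator \<open>A = diag (v / w) M\<close> is self-adjoint with Perron vector
    \<open>v\<close> of eigenvalue \<open>1\<close>, and \<open>key\<close> says \<open>A \<le> A\<^sup>2\<close>: each eigenvalue is \<open>\<le> 0\<close> or \<open>\<ge> 1\<close>. A positive one on
    the complement of \<open>v\<close> would be \<open>1\<close>, against connectedness.\<close>
  define \<rho> where "\<rho> i = w i / v i" for i
  have \<rho>: "0 < \<rho> i" if "i \<in> I" for i using v[OF that] wpos[OF that] by (simp add: \<rho>_def)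
  define K where "K = {x. (\<forall>i. i \<notin> I \<longrightarrow> x i = 0) \<and> (\<Sum>i\<in>I. \<rho> i * (x i)\<^sup>2) = 1 \<and> (\<Sum>i\<in>I. w i * x i) = 0}"
  define nrm where "nrm x = (\<Sum>i\<in>I. \<rho> i * (x i)\<^sup>2)" for x
  have normalize: "\<exists>y\<in>K. bil I M x x = nrm x * bil I M y y"
    if "0 < nrm x" "(\<Sum>i\<in>I. w i * x i) = 0" for x
  proof -
    define y where "y i = (if i \<in> I then x i / sqrt (nrm x) else 0)" for i
    have "(\<Sum>i\<in>I. \<rho> i * (y i)\<^sup>2) = (\<Sum>i\<in>I. \<rho> i * (x i)\<^sup>2 / nrm x)"
      using that by (intro sum.cong refl) (simp add: y_def power_divide)
    also have "\<dots> = 1" using that by (simp add: sum_divide_distrib[symmetric] nrm_def[symmetric])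
    finally have 1: "(\<Sum>i\<in>I. \<rho> i * (y i)\<^sup>2) = 1" .
    have "(\<Sum>i\<in>I. w i * y i) = (\<Sum>i\<in>I. w i * x i / sqrt (nrm x))"
      by (intro sum.cong refl) (simp add: y_def)
    also have "\<dots> = 0" using that by (simp add: sum_divide_distrib[symmetric])
    finally have "y \<in> K" using 1 by (simp add: K_def y_def)
    moreover have "nrm x * bil I M y y = bil I M x x"
      unfolding bil_def sum_distrib_left using that
      by (intro sum.cong refl) (simp add: y_def field_simps)
    ultimately show ?thesis by metis
  qed
  have "bil I M x0 x0 \<le> 0" if x0: "(\<Sum>i\<in>I. w i * x0 i) = 0" for x0
  proof (rule ccontr)
    assume "\<not> bil I M x0 x0 \<le> 0"
    then have b0: "0 < bil I M x0 x0" by simp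
    have "0 \<le> nrm x0" unfolding nrm_def using \<rho> by (intro sum_nonneg) (simp add: less_imp_le)
    moreover have "nrm x0 \<noteq> 0"
    proof
      assume "nrm x0 = 0"
      then have "\<forall>i\<in>I. \<rho> i * (x0 i)\<^sup>2 = 0"
        using \<rho> unfolding nrm_def by (subst (asm) sum_nonneg_eq_0_iff) (auto simp: fin less_imp_le)
      then have "x0 i = 0" if "i \<in> I" for i using that \<rho>[OF that] by fastforce
      then have "bil I M x0 x0 = 0" by (simp add: bil_def)
      then show False using b0 by simp
    qed
    ultimately have n0: "0 < nrm x0" by simp
    from normalize[OF n0 x0] obtain y0 where y0: "y0 \<in> K" "bil I M x0 x0 = nrm x0 * bil I M y0 y0"
      by blast
    then have "K \<noteq> {}" by blast
    \<comment> \<open>Since \<open>\<rho> i * v i = w i\<close>, the linear condition in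
      \<open>K\<close> is orthogonality to \<open>v\<close> in the inner product with weights
      \<open>\<rho>\<close>. The maximizer is the candidate for the top eigenvector of
      \<open>A\<close> on this complement.\<close>
    from sphere_form_attains_max[OF fin \<rho> K_def this, where M=M] obtain x where
      x: "x \<in> K" "\<And>y. y \<in> K \<Longrightarrow> bil I M y y \<le> bil I M x x" by blast
    define \<mu> where "\<mu> = bil I M x x"
    have \<mu>: "0 < \<mu>"
      using y0 b0 n0 x(2)[OF y0(1)] by (simp add: \<mu>_def zero_less_mult_iff)
    have xs: "(\<Sum>i\<in>I. w i * x i) = 0" "nrm x = 1" using x(1) by (auto simp: K_def nrm_def)
    have max: "bil I M y y \<le> \<mu> * nrm y" if y: "(\<Sum>i\<in>I. w i * y i) = 0" for y
    proof (cases "nrm y > 0")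
      case True
      from normalize[OF True y] obtain z where "z \<in> K" "bil I M y y = nrm y * bil I M z z" by blast
      then show ?thesis using x(2)[of z] True by (simp add: \<mu>_def)
    next
      case False
      moreover have "0 \<le> nrm y" unfolding nrm_def using \<rho> by (intro sum_nonneg) (simp add: less_imp_le)
      ultimately have n: "nrm y = 0" by simp
      then have "\<forall>i\<in>I. \<rho> i * (y i)\<^sup>2 = 0"
        using \<rho> unfolding nrm_def by (subst (asm) sum_nonneg_eq_0_iff) (auto simp: fin less_imp_le)
      then have "y i = 0" if "i \<in> I" for i using that \<rho>[OF that] by fastforce
      then show ?thesis using n by (simp add: bil_def)
    qed
    define Mx where "Mx i = (\<Sum>k\<in>I. M i k * x k)" for i
    \<comment> \<open>The residual \<open>A x - \<mu> x\<close>. It lies in the complement of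
      \<open>v\<close> as \<open>A\<close> is self-adjoint and fixes \<open>v\<close>; varying
      \<open>x\<close> in this direction has first-order term \<open>2 * t * nrm z\<close>, so
      maximality forces \<open>z = 0\<close>.\<close>
    define z where "z i = Mx i / \<rho> i - \<mu> * x i" for i
    have "(\<Sum>i\<in>I. w i * z i) = (\<Sum>i\<in>I. v i * Mx i) - \<mu> * (\<Sum>i\<in>I. w i * x i)"
      using v wpos by (simp add: z_def \<rho>_def sum_distrib_left sum_subtractf[symmetric] algebra_simps)
        (rule sum.cong[OF refl], smt (verit) nonzero_mult_div_cancel_left)
    also have "(\<Sum>i\<in>I. v i * Mx i) = bil I M v x" by (simp add: bil_row Mx_def)
    also have "\<dots> = bil I M x v" using Msym by (intro bil_sym) auto
    also have "\<dots> = (\<Sum>i\<in>I. w i * x i)" by (simp add: bil_row w mult.commute)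
    finally have z0: "(\<Sum>i\<in>I. w i * z i) = 0" using xs by simp
    have Mx: "Mx i = \<rho> i * z i + \<mu> * (\<rho> i * x i)" if "i \<in> I" for i
      using \<rho>[OF that] by (simp add: z_def field_simps)
    have bxz: "bil I M x z = nrm z + \<mu> * (\<Sum>i\<in>I. \<rho> i * x i * z i)"
    proof -
      have "bil I M x z = bil I M z x" using Msym by (intro bil_sym) auto
      also have "\<dots> = (\<Sum>i\<in>I. z i * Mx i)" by (simp add: bil_row Mx_def)
      also have "\<dots> = (\<Sum>i\<in>I. \<rho> i * (z i)\<^sup>2 + \<mu> * (\<rho> i * x i * z i))"
        by (intro sum.cong refl) (simp add: Mx power2_eq_square algebra_simps)
      finally show ?thesis by (simp add: nrm_def sum.distrib sum_distrib_left)
    qed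
    have "2 * t * nrm z + t\<^sup>2 * (bil I M z z - \<mu> * nrm z) \<le> 0" for t
    proof -
      have "(\<Sum>i\<in>I. w i * (x i + t * z i)) = (\<Sum>i\<in>I. w i * x i) + t * (\<Sum>i\<in>I. w i * z i)"
        by (simp add: sum_distrib_left sum.distrib algebra_simps)
      then have "bil I M (\<lambda>i. x i + t * z i) (\<lambda>i. x i + t * z i) \<le> \<mu> * nrm (\<lambda>i. x i + t * z i)"
        using xs z0 by (intro max) simp
      moreover have "nrm (\<lambda>i. x i + t * z i) = nrm x + 2 * t * (\<Sum>i\<in>I. \<rho> i * x i * z i) + t\<^sup>2 * nrm z"
        by (simp add: nrm_def sum_distrib_left sum.distrib power2_eq_square algebra_simps)
      ultimately show ?thesis
        using bil_add_scaled[of I M x t z] Msym xs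
        by (simp add: bxz \<mu>_def[symmetric] algebra_simps)
    qed
    then have "nrm z = 0" by (rule linear_coeff_zero)
    then have "\<forall>i\<in>I. \<rho> i * (z i)\<^sup>2 = 0"
      using \<rho> unfolding nrm_def by (subst (asm) sum_nonneg_eq_0_iff) (auto simp: fin less_imp_le)
    then have "z i = 0" if "i \<in> I" for i using that \<rho>[OF that] by fastforce
    then have eig: "Mx i = \<mu> * (\<rho> i * x i)" if "i \<in> I" for i using Mx that by simp
    \<comment> \<open>At an eigenvector, \<open>key\<close> reads
      \<open>\<mu> \<le> \<mu> * \<mu>\<close>.\<close>
    have "\<mu> \<le> (\<Sum>i\<in>I. v i / w i * (Mx i)\<^sup>2)" using key[of x] by (simp add: \<mu>_def Mx_def)
    also have "\<dots> = (\<Sum>i\<in>I. \<mu>\<^sup>2 * (\<rho> i * (x i)\<^sup>2))"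
      using v wpos by (intro sum.cong refl) (simp add: eig \<rho>_def power2_eq_square field_simps)
    also have "\<dots> = \<mu>\<^sup>2" using xs(2) by (simp add: nrm_def sum_distrib_left[symmetric])
    finally have \<mu>1: "1 \<le> \<mu>" using \<mu> by (simp add: power2_eq_square)
    let ?t = "\<lambda>i j. M i j * v i * v j * (x i / v i - x j / v j)\<^sup>2"
    have tnn: "0 \<le> ?t i j" if "i \<in> I" "j \<in> I" for i j
      using Mnn[OF that] v[OF that(1)] v[OF that(2)] by simp
    define S where "S = (\<Sum>i\<in>I. \<Sum>j\<in>I. ?t i j)"
    \<comment> \<open>Here \<open>(M v) i / v i = \<rho> i\<close> and \<open>nrm x = 1\<close>. As
      \<open>S\<close> is nonnegative and \<open>\<mu>\<close> is at least \<open>1\<close>, every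
      term of \<open>S\<close> must vanish.\<close>
    have "S = 2 * (1 - \<mu>)"
      unfolding S_def
      using perron_identity[OF fin Msym v, where x = x] xs(2)
      by (simp add: w[symmetric] \<mu>_def[symmetric] nrm_def \<rho>_def)
    moreover have "0 \<le> S" unfolding S_def using tnn by (intro sum_nonneg)
    ultimately have "S = 0" using \<mu>1 by (intro antisym) simp_all
    then have "\<forall>i\<in>I. (\<Sum>j\<in>I. ?t i j) = 0"
      using tnn unfolding S_def by (subst (asm) sum_nonneg_eq_0_iff) (auto simp: fin intro!: sum_nonneg)
    then have t0: "?t i j = 0" if "i \<in> I" "j \<in> I" for i j
      using tnn sum_nonneg_eq_0_iff[OF fin, of "?t i"] that by blast
    have const: "x i / v i = x j / v j" if "i \<in> I" "j \<in> I" for i j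
    proof (rule conn[OF _ that])
      fix j k assume "j \<in> I" "k \<in> I" "0 < M j k"
      then show "x j / v j = x k / v k" using t0[of j k] v[of j] v[of k] by simp
    qed
    have "I \<noteq> {}" using xs(2) by (auto simp: nrm_def)
    then obtain i0 where i0: "i0 \<in> I" by blast
    define c where "c = x i0 / v i0"
    have xc: "x i = c * v i" if "i \<in> I" for i
      using const[OF that i0] v[OF that] by (simp add: c_def field_simps)
    \<comment> \<open>A multiple of the positive vector \<open>v\<close> is orthogonal to
      \<open>v\<close> only if it is zero.\<close>
    have "(\<Sum>i\<in>I. w i * x i) = c * (\<Sum>i\<in>I. w i * v i)"
      by (simp add: xc sum_distrib_left mult_ac)
    moreover have "(\<Sum>i\<in>I. w i * v i) > 0"
      using v wpos \<open>I \<noteq> {}\<close> fin by (intro sum_pos) auto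
    ultimately have "c = 0" using xs(1) by simp
    then have "nrm x = 0" by (simp add: nrm_def xc)
    then show False using xs(2) by simp
  qed
  then show ?thesis using Msym Mnn by (intro lorentz_formI[where l = w]) auto
qed

text \<open>Removes the positivity of \<open>M v\<close>. If row \<open>j\<close> of
  \<open>M\<close> vanishes, nonnegativity and symmetry kill every entry of \<open>T\<close> with
  index \<open>j\<close>, so all forms live on the set \<open>I'\<close> of indices with a nonzero
  row; connectedness is therefore required only there.\<close>

lemma lorentz_form_sum:
  fixes T :: "'i \<Rightarrow> 'i \<Rightarrow> 'i \<Rightarrow> real" and v :: "'i \<Rightarrow> real"
  assumes fin: "finite I"
    and sym: "\<And>i j k. i \<in> I \<Longrightarrow> j \<in> I \<Longrightarrow> k \<in> I \<Longrightarrow> T i j k = T j i k"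
    and sym': "\<And>i j k. i \<in> I \<Longrightarrow> j \<in> I \<Longrightarrow> k \<in> I \<Longrightarrow> T i j k = T i k j"
    and nonneg: "\<And>i j k. i \<in> I \<Longrightarrow> j \<in> I \<Longrightarrow> k \<in> I \<Longrightarrow> 0 \<le> T i j k"
    and v: "\<And>i. i \<in> I \<Longrightarrow> 0 < v i"
    and lor: "\<And>i. i \<in> I \<Longrightarrow> lorentz_form I (T i)"
    and M: "\<And>j k. M j k = (\<Sum>i\<in>I. v i * T i j k)"
    and conn: "\<And>z j k j' k'. (\<And>j k. j \<in> I \<Longrightarrow> k \<in> I \<Longrightarrow> 0 < M j k \<Longrightarrow> z j = (z k :: real)) \<Longrightarrow>
        j \<in> I \<Longrightarrow> k \<in> I \<Longrightarrow> j' \<in> I \<Longrightarrow> k' \<in> I \<Longrightarrow> 0 < M j j' \<Longrightarrow> 0 < M k k' \<Longrightarrow> z j = z k"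
  shows "lorentz_form I M"
proof -
  have Mnn: "0 \<le> M j k" if "j \<in> I" "k \<in> I" for j k
    unfolding M using that nonneg v by (intro sum_nonneg mult_nonneg_nonneg) (auto simp: less_imp_le)
  define I' where "I' = {j \<in> I. \<exists>k\<in>I. 0 < M j k}"
  have I': "I' \<subseteq> I" "finite I'" using fin by (auto simp: I'_def)
  have M0: "M j k = 0" if "j \<in> I" "k \<in> I" "j \<notin> I'" for j k
    using that Mnn[of j k] unfolding I'_def by force
  have T1: "T i j k = 0" if "i \<in> I" "j \<in> I" "k \<in> I" "j \<notin> I'" for i j k
  proof -
    have "(\<Sum>i\<in>I. v i * T i j k) = 0" using M0[of j k] that by (simp add: M)
    then have "v i * T i j k = 0"
      using that nonneg v by (subst (asm) sum_nonneg_eq_0_iff) (auto simp: fin less_imp_le)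
    then show ?thesis using v[OF that(1)] by simp
  qed
  have T0: "T i j k = 0" if "i \<in> I" "j \<in> I" "k \<in> I" "i \<notin> I' \<or> j \<notin> I' \<or> k \<notin> I'" for i j k
    using that T1[of i j k] T1[of j i k] T1[of i k j] sym[of i j k] sym'[of i j k]
      T1[of j k i] T1[of k i j] sym'[of j i k] sym[of i k j]
    by auto
  have M': "M j k = (\<Sum>i\<in>I'. v i * T i j k)" if "j \<in> I" "k \<in> I" for j k
    unfolding M using that I' fin T0 by (intro sum.mono_neutral_right) auto
  have "lorentz_form I' (\<lambda>j k. \<Sum>i\<in>I'. v i * T i j k)"
  proof (rule lorentz_form_sum_pos[where T = T and v = v])
    show "lorentz_form I' (T i)" if "i \<in> I'" for i
      using lor[of i] that I' T0[of i] lorentz_form_mono_neutral[OF fin I'(1), of "T i"] by blast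
    show "0 < (\<Sum>k\<in>I'. (\<Sum>i\<in>I'. v i * T i j k) * v k)" if "j \<in> I'" for j
    proof -
      from that obtain k where k: "k \<in> I" "0 < M j k" by (auto simp: I'_def)
      have "k \<in> I'"
        using k T0[of _ j k] that I' M[of j k] by (cases "k \<in> I'") auto
      show ?thesis
      proof (rule sum_pos2[of _ k])
        show "0 < (\<Sum>i\<in>I'. v i * T i j k) * v k"
          using M'[of j k] k that I' v by auto
        show "0 \<le> (\<Sum>i\<in>I'. v i * T i j k) * v k" if "k \<in> I'" for k
          using M'[of j k] Mnn[of j k] that \<open>j \<in> I'\<close> I' v[of k] by (auto simp: subset_iff)
      qed (use I' \<open>k \<in> I'\<close> in auto)
    qed
    show "z j = z k" if z: "\<And>j k. j \<in> I' \<Longrightarrow> k \<in> I' \<Longrightarrow> 0 < (\<Sum>i\<in>I'. v i * T i j k) \<Longrightarrow> z j = z k"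
      and jk: "j \<in> I'" "k \<in> I'" for z :: "'i \<Rightarrow> real" and j k
    proof -
      from jk obtain j' k' where jk': "j' \<in> I" "k' \<in> I" "0 < M j j'" "0 < M k k'"
        by (auto simp: I'_def)
      show ?thesis
      proof (rule conn[of z j k j' k'])
        fix j k assume h: "j \<in> I" "k \<in> I" "0 < M j k"
        have "j \<in> I'" using h by (auto simp: I'_def)
        moreover have "k \<in> I'"
          using h T0[of _ j k] M[of j k] by (cases "k \<in> I'") auto
        ultimately show "z j = z k" using h M' by (intro z) auto
      qed (use jk jk' I' in auto)
    qed
    fix i j k assume ijk: "i \<in> I'" "j \<in> I'" "k \<in> I'"
    show "T i j k = T j i k" using ijk I' by (intro sym) auto
    show "T i j k = T i k j" using ijk I' by (intro sym') auto
    show "0 \<le> T i j k" using ijk I' by (intro nonneg) auto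
  qed (use I' v in auto)
  then have "lorentz_form I' M"
    by (subst lorentz_form_cong[of I' M]) (use M' I' in auto)
  moreover have "M i j = 0" if "i \<in> I" "j \<in> I" "i \<notin> I' \<or> j \<notin> I'" for i j
    using that T0[of _ i j] by (simp add: M)
  ultimately show ?thesis using lorentz_form_mono_neutral[OF fin I'(1), of M] by blast
qed

text \<open>A homogeneous polynomial is represented by the map that sends a multiset \<open>\<alpha>\<close> of variables, of
  size its degree, to its \<open>\<alpha>\<close>-th partial derivative; \<open>ddir\<close> is then the directional derivative.\<close>

definition ddir :: "'i set \<Rightarrow> ('i \<Rightarrow> real) \<Rightarrow> ('i multiset \<Rightarrow> real) \<Rightarrow> 'i multiset \<Rightarrow> real" where
  "ddir I v c \<alpha> = (\<Sum>i\<in>I. v i * c (add_mset i \<alpha>))"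

definition lorentzian :: "'i set \<Rightarrow> nat \<Rightarrow> ('i multiset \<Rightarrow> real) \<Rightarrow> bool" where
  "lorentzian I d c \<longleftrightarrow> (\<forall>vs. length vs + 2 = d \<longrightarrow> (\<forall>v\<in>set vs. \<forall>i\<in>I. 0 \<le> v i) \<longrightarrow>
     lorentz_form I (\<lambda>i j. foldr (ddir I) vs c {#i, j#}))"

lemma ddir_commute: "ddir I u (ddir I v c) = ddir I v (ddir I u c)"
proof
  fix \<alpha>
  have "ddir I u (ddir I v c) \<alpha> = (\<Sum>i\<in>I. \<Sum>j\<in>I. u i * (v j * c (add_mset j (add_mset i \<alpha>))))"
    by (simp add: ddir_def sum_distrib_left)
  also have "\<dots> = (\<Sum>j\<in>I. \<Sum>i\<in>I. u i * (v j * c (add_mset j (add_mset i \<alpha>))))"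
    by (rule sum.swap)
  also have "\<dots> = ddir I v (ddir I u c) \<alpha>"
    by (simp add: ddir_def sum_distrib_left mult.left_commute add_mset_commute)
  finally show "ddir I u (ddir I v c) \<alpha> = ddir I v (ddir I u c) \<alpha>" .
qed

lemma foldr_ddir_Cons:
  "foldr (ddir I) (v # vs) c \<alpha> = (\<Sum>i\<in>I. v i * foldr (ddir I) vs c (add_mset i \<alpha>))"
  by (simp only: foldr.simps o_apply) (rule ddir_def)

lemma foldr_ddir_shift:
  "foldr (ddir I) vs (\<lambda>\<alpha>. c (add_mset i \<alpha>)) \<alpha> = foldr (ddir I) vs c (add_mset i \<alpha>)"
  by (induction vs arbitrary: \<alpha>) (simp_all add: ddir_def add_mset_commute)

lemma foldr_ddir_nonneg:
  assumes "\<And>\<alpha>. 0 \<le> c \<alpha>" "\<And>v i. v \<in> set vs \<Longrightarrow> i \<in> I \<Longrightarrow> 0 \<le> v i"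
  shows "0 \<le> foldr (ddir I) vs c \<alpha>"
  using assms(2) by (induction vs arbitrary: \<alpha>) (auto simp: ddir_def assms(1) intro!: sum_nonneg)

text \<open>The iterated derivative is a combination with positive weights of the values
  \<open>c (\<alpha> + \<beta>)\<close>. Hence which Hessian entries are positive depends on the
  support of the polynomial and not on the directions.\<close>

lemma foldr_ddir_pos_iff:
  assumes "finite I" "\<And>\<alpha>. 0 \<le> c \<alpha>" "\<And>v i. v \<in> set vs \<Longrightarrow> i \<in> I \<Longrightarrow> 0 < v i"
  shows "0 < foldr (ddir I) vs c \<alpha> \<longleftrightarrow>
    (\<exists>\<beta>. size \<beta> = length vs \<and> set_mset \<beta> \<subseteq> I \<and> 0 < c (\<alpha> + \<beta>))"
  using assms(3)
proof (induction vs arbitrary: \<alpha>)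
  case (Cons v vs)
  have nn: "0 \<le> foldr (ddir I) vs c \<beta>" for \<beta>
    using assms(2) Cons.prems by (intro foldr_ddir_nonneg) (auto simp: less_imp_le)
  have "0 < foldr (ddir I) (v # vs) c \<alpha> \<longleftrightarrow> (\<exists>i\<in>I. 0 < v i * foldr (ddir I) vs c (add_mset i \<alpha>))"
  proof
    assume L: "0 < foldr (ddir I) (v # vs) c \<alpha>"
    show "\<exists>i\<in>I. 0 < v i * foldr (ddir I) vs c (add_mset i \<alpha>)"
    proof (rule ccontr)
      assume "\<not> ?thesis"
      then have "(\<Sum>i\<in>I. v i * foldr (ddir I) vs c (add_mset i \<alpha>)) \<le> 0"
        by (intro sum_nonpos) (auto simp: not_less)
      then show False using L by (simp add: ddir_def)
    qed
  next
    assume "\<exists>i\<in>I. 0 < v i * foldr (ddir I) vs c (add_mset i \<alpha>)"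
    then obtain i where i: "i \<in> I" "0 < v i * foldr (ddir I) vs c (add_mset i \<alpha>)" by blast
    have "0 < (\<Sum>i\<in>I. v i * foldr (ddir I) vs c (add_mset i \<alpha>))"
    proof (rule sum_pos2[where i = i])
      show "0 \<le> v j * foldr (ddir I) vs c (add_mset j \<alpha>)" if "j \<in> I" for j
        using that nn Cons.prems by (intro mult_nonneg_nonneg) (auto intro: less_imp_le)
    qed (use assms(1) i in auto)
    then show "0 < foldr (ddir I) (v # vs) c \<alpha>" by (simp add: ddir_def)
  qed
  also have "\<dots> \<longleftrightarrow> (\<exists>i\<in>I. 0 < foldr (ddir I) vs c (add_mset i \<alpha>))"
  proof (intro bex_cong refl)
    fix i assume "i \<in> I"
    then have "0 < v i" using Cons.prems by simp
    then show "0 < v i * foldr (ddir I) vs c (add_mset i \<alpha>) \<longleftrightarrow> 0 < foldr (ddir I) vs c (add_mset i \<alpha>)"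
      by (metis zero_less_mult_pos mult_pos_pos)
  qed
  also have "\<dots> \<longleftrightarrow> (\<exists>i\<in>I. \<exists>\<beta>. size \<beta> = length vs \<and> set_mset \<beta> \<subseteq> I \<and> 0 < c (add_mset i \<alpha> + \<beta>))"
    by (intro bex_cong refl Cons.IH) (use Cons.prems in auto)
  also have "\<dots> \<longleftrightarrow> (\<exists>\<beta>. size \<beta> = Suc (length vs) \<and> set_mset \<beta> \<subseteq> I \<and> 0 < c (\<alpha> + \<beta>))"
  proof
    assume "\<exists>i\<in>I. \<exists>\<beta>. size \<beta> = length vs \<and> set_mset \<beta> \<subseteq> I \<and> 0 < c (add_mset i \<alpha> + \<beta>)"
    then obtain i \<beta> where "i \<in> I" "size \<beta> = length vs" "set_mset \<beta> \<subseteq> I" "0 < c (add_mset i \<alpha> + \<beta>)"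
      by blast
    then show "\<exists>\<beta>. size \<beta> = Suc (length vs) \<and> set_mset \<beta> \<subseteq> I \<and> 0 < c (\<alpha> + \<beta>)"
      by (intro exI[of _ "add_mset i \<beta>"]) auto
  next
    assume "\<exists>\<beta>. size \<beta> = Suc (length vs) \<and> set_mset \<beta> \<subseteq> I \<and> 0 < c (\<alpha> + \<beta>)"
    then obtain \<beta> where \<beta>: "size \<beta> = Suc (length vs)" "set_mset \<beta> \<subseteq> I" "0 < c (\<alpha> + \<beta>)" by blast
    from size_eq_Suc_imp_eq_union[OF \<beta>(1)] obtain i \<beta>' where "\<beta> = add_mset i \<beta>'" by blast
    with \<beta> show "\<exists>i\<in>I. \<exists>\<beta>. size \<beta> = length vs \<and> set_mset \<beta> \<subseteq> I \<and> 0 < c (add_mset i \<alpha> + \<beta>)"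
      by (intro bexI[of _ i] exI[of _ \<beta>']) auto
  qed
  finally show ?case by simp
qed simp

lemma tendsto_foldr_ddir:
  assumes "e \<longlonglongrightarrow> 0"
  shows "(\<lambda>n. foldr (ddir I) (map (\<lambda>v i. v i + e n) vs) c \<alpha>) \<longlonglongrightarrow> foldr (ddir I) vs c \<alpha>"
proof (induction vs arbitrary: \<alpha>)
  case (Cons v vs)
  have "(\<lambda>n. \<Sum>i\<in>I. (v i + e n) * foldr (ddir I) (map (\<lambda>v i. v i + e n) vs) c (add_mset i \<alpha>))
      \<longlonglongrightarrow> (\<Sum>i\<in>I. (v i + 0) * foldr (ddir I) vs c (add_mset i \<alpha>))"
    by (intro tendsto_intros Cons.IH assms)
  then show ?case by (simp only: list.map foldr_ddir_Cons add_0_right)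
qed simp

text \<open>Peeling off one direction \<open>v\<close> writes the Hessian as the sum of
  \<open>v i\<close> times Hessians that come from the partial derivatives, which have degree
  \<open>d\<close>. \<open>conn\<close> says that the polynomial is not a sum of two nonzero
  polynomials in disjoint sets of variables.\<close>

lemma lorentzian_SucI:
  assumes fin: "finite I" and nonneg: "\<And>\<alpha>. 0 \<le> c \<alpha>" and d: "2 \<le> d"
    and lor: "\<And>i. i \<in> I \<Longrightarrow> lorentzian I d (\<lambda>\<alpha>. c (add_mset i \<alpha>))"
    and conn: "\<And>z \<alpha> \<beta> j k.
      (\<And>\<alpha> j k. size \<alpha> = Suc d \<Longrightarrow> set_mset \<alpha> \<subseteq> I \<Longrightarrow> 0 < c \<alpha> \<Longrightarrow> j \<in># \<alpha> \<Longrightarrow> k \<in># \<alpha> \<Longrightarrow> z j = (z k :: real)) \<Longrightarrow>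
      size \<alpha> = Suc d \<Longrightarrow> set_mset \<alpha> \<subseteq> I \<Longrightarrow> 0 < c \<alpha> \<Longrightarrow> j \<in># \<alpha> \<Longrightarrow>
      size \<beta> = Suc d \<Longrightarrow> set_mset \<beta> \<subseteq> I \<Longrightarrow> 0 < c \<beta> \<Longrightarrow> k \<in># \<beta> \<Longrightarrow> z j = z k"
  shows "lorentzian I (Suc d) c"
proof -
  have pos: "lorentz_form I (\<lambda>i j. foldr (ddir I) vs c {#i, j#})"
    if len: "length vs + 2 = Suc d" and vs: "\<And>v i. v \<in> set vs \<Longrightarrow> i \<in> I \<Longrightarrow> 0 < v i" for vs
  proof -
    \<comment> \<open>There are \<open>d - 1\<close> directions, so \<open>2 \<le> d\<close>
      guarantees one to peel off.\<close>
    from len d obtain v ws where vw: "vs = v # ws" by (cases vs) auto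
    define T where "T i j k = foldr (ddir I) ws c {#i, j, k#}" for i j k
    define M where "M j k = foldr (ddir I) vs c {#j, k#}" for j k
    have Mpos: "0 < M j k \<longleftrightarrow> (\<exists>\<beta>. size \<beta> + 2 = Suc d \<and> set_mset \<beta> \<subseteq> I \<and> 0 < c ({#j, k#} + \<beta>))" for j k
      unfolding M_def using foldr_ddir_pos_iff[OF fin, of c vs] nonneg vs len by auto
    have "lorentz_form I M"
    proof (rule lorentz_form_sum[OF fin])
      show "T i j k = T j i k" "T i j k = T i k j" for i j k
        by (simp_all add: T_def add_mset_commute)
      show "0 \<le> T i j k" for i j k
        unfolding T_def using nonneg vs by (intro foldr_ddir_nonneg) (auto simp: vw less_imp_le)
      show "0 < v i" if "i \<in> I" for i using vs that by (simp add: vw)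
      show "lorentz_form I (T i)" if "i \<in> I" for i
      proof -
        have "lorentz_form I (\<lambda>j k. foldr (ddir I) ws (\<lambda>\<alpha>. c (add_mset i \<alpha>)) {#j, k#})"
          using lor[OF that] len vs unfolding lorentzian_def vw by (auto simp: less_imp_le)
        then show ?thesis unfolding foldr_ddir_shift T_def .
      qed
      show "M j k = (\<Sum>i\<in>I. v i * T i j k)" for j k
        by (simp add: M_def T_def vw ddir_def)
      show "z j = z k"
        if z: "\<And>j k. j \<in> I \<Longrightarrow> k \<in> I \<Longrightarrow> 0 < M j k \<Longrightarrow> z j = z k"
          and I: "j \<in> I" "k \<in> I" "j' \<in> I" "k' \<in> I" and jk: "0 < M j j'" "0 < M k k'"
        for z :: "'a \<Rightarrow> real" and j k j' k'
      proof -
        from jk obtain \<alpha> \<beta> where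
          *: "size \<alpha> + 2 = Suc d" "set_mset \<alpha> \<subseteq> I" "0 < c ({#j, j'#} + \<alpha>)"
             "size \<beta> + 2 = Suc d" "set_mset \<beta> \<subseteq> I" "0 < c ({#k, k'#} + \<beta>)"
          unfolding Mpos by blast
        show ?thesis
        proof (rule conn[of z "{#j, j'#} + \<alpha>" j "{#k, k'#} + \<beta>" k])
          fix \<gamma> j k
          assume \<gamma>: "size \<gamma> = Suc d" "set_mset \<gamma> \<subseteq> I" "0 < c \<gamma>" "j \<in># \<gamma>" "k \<in># \<gamma>"
          show "z j = z k"
          proof (cases "j = k")
            case False
            from \<gamma>(4) obtain \<gamma>1 where 1: "\<gamma> = add_mset j \<gamma>1" by (meson multi_member_split)
            with \<gamma>(5) False have "k \<in># \<gamma>1" by auto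
            then obtain \<gamma>2 where 2: "\<gamma>1 = add_mset k \<gamma>2" by (meson multi_member_split)
            have "0 < M j k"
              unfolding Mpos using \<gamma> 1 2 by (intro exI[of _ \<gamma>2]) auto
            then show ?thesis using \<gamma> by (intro z) auto
          qed simp
        qed (use * I in auto)
      qed
    qed
    moreover have "M = (\<lambda>i j. foldr (ddir I) vs c {#i, j#})" by (intro ext M_def)
    ultimately show ?thesis by simp
  qed
  show ?thesis
    unfolding lorentzian_def
  proof (intro allI impI)
    fix vs :: "('a \<Rightarrow> real) list"
    assume len: "length vs + 2 = Suc d" and vs: "\<forall>v\<in>set vs. \<forall>i\<in>I. 0 \<le> v i"
    \<comment> \<open>Adding \<open>e n\<close> makes all directions strictly positive; the defining
      inequality survives the limit.\<close>
    define e where "e n = 1 / real (Suc n)" for n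
    have e: "e \<longlonglongrightarrow> 0" unfolding e_def by (rule LIMSEQ_Suc[OF lim_1_over_n])
    let ?F = "\<lambda>n. (\<lambda>i j. foldr (ddir I) (map (\<lambda>v i. v i + e n) vs) c {#i, j#})"
    let ?G = "\<lambda>i j. foldr (ddir I) vs c {#i, j#}"
    have lim: "(\<lambda>n. bil I (?F n) x y) \<longlonglongrightarrow> bil I ?G x y" for x y
      unfolding bil_def by (intro tendsto_intros tendsto_foldr_ddir e)
    have F: "lorentz_form I (?F n)" for n
      using len vs by (intro pos) (auto simp: e_def add_nonneg_pos)
    show "lorentz_form I ?G"
      unfolding lorentz_form_def
    proof (intro allI impI)
      fix x p :: "'a \<Rightarrow> real" assume p: "\<forall>i\<in>I. 0 \<le> p i"
      have "\<And>n. bil I (?F n) x x * bil I (?F n) p p \<le> (bil I (?F n) x p)\<^sup>2"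
        using F p unfolding lorentz_form_def by blast
      then show "bil I ?G x x * bil I ?G p p \<le> (bil I ?G x p)\<^sup>2"
        by (intro LIMSEQ_le[OF tendsto_mult[OF lim lim] tendsto_power[OF lim]]) auto
    qed
  qed
qed

section \<open>Quadratic forms of ultrametric type\<close>

text \<open>The polynomial is squarefree in the \<open>w\<close> variables, so its Hessian has zero
  diagonal there. The later choice \<open>\<beta> i j = b {i, j}\<close> has the diagonal values
  \<open>b {i}\<close>, which must not enter.\<close>

definition offdiag :: "('i \<Rightarrow> 'i \<Rightarrow> real) \<Rightarrow> 'i \<Rightarrow> 'i \<Rightarrow> real" where
  "offdiag \<beta> i j = (if i = j then 0 else \<beta> i j)"

lemma bil_offdiag:
  assumes "finite R"
  shows "bil R (offdiag \<beta>) x x = (\<Sum>i\<in>R. \<Sum>j\<in>R - {i}. \<beta> i j * x i * x j)"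
  unfolding bil_def using assms
  by (intro sum.cong refl sum.mono_neutral_cong_right) (auto simp: offdiag_def)

lemma bil_Un:
  assumes "finite P" "finite Z" "P \<inter> Z = {}"
    and "\<And>i j. i \<in> P \<union> Z \<Longrightarrow> j \<in> P \<union> Z \<Longrightarrow> M i j = M j i"
  shows "bil (P \<union> Z) M x x = bil P M x x + bil Z M x x + 2 * (\<Sum>i\<in>Z. \<Sum>j\<in>P. x i * M i j * x j)"
proof -
  have "bil (P \<union> Z) M x x = bil P M x x + (\<Sum>i\<in>P. \<Sum>j\<in>Z. x i * M i j * x j)
      + ((\<Sum>i\<in>Z. \<Sum>j\<in>P. x i * M i j * x j) + bil Z M x x)"
    unfolding bil_def using assms(1-3) by (simp add: sum.union_disjoint sum.distrib)
  also have "(\<Sum>i\<in>P. \<Sum>j\<in>Z. x i * M i j * x j) = (\<Sum>j\<in>Z. \<Sum>i\<in>P. x i * M i j * x j)"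
    by (rule sum.swap)
  also have "\<dots> = (\<Sum>i\<in>Z. \<Sum>j\<in>P. x i * M i j * x j)"
    using assms(4) by (intro sum.cong refl) simp
  finally show ?thesis by simp
qed

text \<open>Rescaling \<open>x i\<close> to \<open>\<alpha> i * x i\<close> replaces
  \<open>\<beta> i j\<close> by \<open>\<beta> i j / (\<alpha> i * \<alpha> j)\<close>;
  \<open>exch\<close> divided by \<open>\<alpha> i * \<alpha> j * \<alpha> k\<close> is the
  ultrametric inequality.\<close>

lemma weighted_ultrametric_form_le:
  assumes "finite R" and sym: "\<And>i j. i \<in> R \<Longrightarrow> j \<in> R \<Longrightarrow> \<beta> i j = \<beta> j i"
    and nonneg: "\<And>i j. i \<in> R \<Longrightarrow> j \<in> R \<Longrightarrow> 0 \<le> \<beta> i j"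
    and \<alpha>: "\<And>i. i \<in> R \<Longrightarrow> 0 < \<alpha> i"
    and exch: "\<And>i j k. i \<in> R \<Longrightarrow> j \<in> R \<Longrightarrow> k \<in> R \<Longrightarrow> i \<noteq> j \<Longrightarrow> i \<noteq> k \<Longrightarrow> j \<noteq> k \<Longrightarrow>
        \<alpha> k * \<beta> i j \<le> max (\<alpha> i * \<beta> j k) (\<alpha> j * \<beta> i k)"
    and B: "0 \<le> B" "\<And>i j. i \<in> R \<Longrightarrow> j \<in> R \<Longrightarrow> i \<noteq> j \<Longrightarrow> \<beta> i j \<le> B * (\<alpha> i * \<alpha> j)"
  shows "bil R (offdiag \<beta>) x x \<le> B * (1 - 1 / real (card R)) * (\<Sum>i\<in>R. \<alpha> i * x i)\<^sup>2"
proof -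
  define b where "b i j = \<beta> i j / (\<alpha> i * \<alpha> j)" for i j
  have "bil R (offdiag \<beta>) x x = (\<Sum>i\<in>R. \<Sum>j\<in>R - {i}. b i j * (\<alpha> i * x i) * (\<alpha> j * x j))"
    unfolding bil_offdiag[OF \<open>finite R\<close>]
  proof (intro sum.cong refl)
    fix i j assume "i \<in> R" "j \<in> R - {i}"
    then show "\<beta> i j * x i * x j = b i j * (\<alpha> i * x i) * (\<alpha> j * x j)"
      using \<alpha>[of i] \<alpha>[of j] by (simp add: b_def field_simps)
  qed
  also have "\<dots> \<le> B * (1 - 1 / real (card R)) * (\<Sum>i\<in>R. \<alpha> i * x i)\<^sup>2"
  proof (rule ultrametric_form_le[OF \<open>finite R\<close>])
    fix i j assume ij: "i \<in> R" "j \<in> R"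
    show "b i j = b j i" using sym[OF ij] by (simp add: b_def mult.commute)
    show "0 \<le> b i j" using nonneg[OF ij] \<alpha>[OF ij(1)] \<alpha>[OF ij(2)] by (simp add: b_def)
    show "b i j \<le> B" if "i \<noteq> j"
      using B(2)[OF ij that] \<alpha>[OF ij(1)] \<alpha>[OF ij(2)] by (simp add: b_def pos_divide_le_eq)
    fix k assume k: "k \<in> R" "i \<noteq> j" "i \<noteq> k" "j \<noteq> k"
    have pos: "0 < \<alpha> i" "0 < \<alpha> j" "0 < \<alpha> k" using \<alpha> ij k by auto
    from exch[OF ij k] show "b i j \<le> max (b i k) (b j k)"
    proof (unfold le_max_iff_disj, elim disjE)
      assume "\<alpha> k * \<beta> i j \<le> \<alpha> i * \<beta> j k"
      then have "b i j \<le> b j k" using pos by (simp add: b_def field_simps)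
      then show "b i j \<le> b i k \<or> b i j \<le> b j k" by simp
    next
      assume "\<alpha> k * \<beta> i j \<le> \<alpha> j * \<beta> i k"
      then have "b i j \<le> b i k" using pos by (simp add: b_def field_simps)
      then show "b i j \<le> b i k \<or> b i j \<le> b j k" by simp
    qed
  qed (rule B)
  finally show ?thesis .
qed

text \<open>The case where the empty set has positive weight \<open>A\<close>: the rescaled entries
  are bounded by \<open>1 / A\<close>, and an index with \<open>\<alpha> i = 0\<close> has no
  nonzero entry and drops out.\<close>

lemma offdiag_form_le_square:
  assumes fin: "finite R" and sym: "\<And>i j. i \<in> R \<Longrightarrow> j \<in> R \<Longrightarrow> \<beta> i j = \<beta> j i"
    and nonneg: "\<And>i j. i \<in> R \<Longrightarrow> j \<in> R \<Longrightarrow> 0 \<le> \<beta> i j"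
    and \<alpha>: "\<And>i. i \<in> R \<Longrightarrow> 0 \<le> \<alpha> i"
    and exch: "\<And>i j k. i \<in> R \<Longrightarrow> j \<in> R \<Longrightarrow> k \<in> R \<Longrightarrow> i \<noteq> j \<Longrightarrow> i \<noteq> k \<Longrightarrow> j \<noteq> k \<Longrightarrow>
        \<alpha> k * \<beta> i j \<le> max (\<alpha> i * \<beta> j k) (\<alpha> j * \<beta> i k)"
    and A: "0 < A" "\<And>i j. i \<in> R \<Longrightarrow> j \<in> R \<Longrightarrow> i \<noteq> j \<Longrightarrow> A * \<beta> i j \<le> \<alpha> i * \<alpha> j"
  shows "A * bil R (offdiag \<beta>) x x \<le> (1 - 1 / real (card R)) * (\<Sum>i\<in>R. \<alpha> i * x i)\<^sup>2"
proof -
  define P where "P = {i \<in> R. 0 < \<alpha> i}"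
  have P: "P \<subseteq> R" "finite P" using fin by (auto simp: P_def)
  have \<alpha>0: "\<alpha> i = 0" if "i \<in> R" "i \<notin> P" for i using that \<alpha>[of i] by (auto simp: P_def)
  have "offdiag \<beta> i j = 0" if "i \<in> R" "j \<in> R" "i \<notin> P \<or> j \<notin> P" for i j
  proof (cases "i = j")
    case False
    then have "A * \<beta> i j \<le> 0" using A(2)[of i j] \<alpha>0 that by fastforce
    then show ?thesis using A(1) nonneg[of i j] that by (auto simp: mult_le_0_iff offdiag_def)
  qed (simp add: offdiag_def)
  then have "bil R (offdiag \<beta>) x x = bil P (offdiag \<beta>) x x"
    by (intro bil_mono_neutral fin P)
  also have "\<dots> \<le> 1 / A * (1 - 1 / real (card P)) * (\<Sum>i\<in>P. \<alpha> i * x i)\<^sup>2"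
  proof (rule weighted_ultrametric_form_le)
    show "\<beta> i j = \<beta> j i" if "i \<in> P" "j \<in> P" for i j
      by (rule sym) (use that P in auto)
    show "0 \<le> \<beta> i j" if "i \<in> P" "j \<in> P" for i j
      by (rule nonneg) (use that P in auto)
    show "\<alpha> k * \<beta> i j \<le> max (\<alpha> i * \<beta> j k) (\<alpha> j * \<beta> i k)"
      if "i \<in> P" "j \<in> P" "k \<in> P" "i \<noteq> j" "i \<noteq> k" "j \<noteq> k" for i j k
      using that P by (intro exch) auto
    show "\<beta> i j \<le> 1 / A * (\<alpha> i * \<alpha> j)" if "i \<in> P" "j \<in> P" "i \<noteq> j" for i j
      using A(2)[of i j] that P A(1) by (auto simp: field_simps)
  qed (use P A in \<open>auto simp: P_def\<close>)
  finally have "A * bil R (offdiag \<beta>) x x \<le> (1 - 1 / real (card P)) * (\<Sum>i\<in>P. \<alpha> i * x i)\<^sup>2"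
    using A(1) by (simp add: field_simps)
  also have "(\<Sum>i\<in>P. \<alpha> i * x i) = (\<Sum>i\<in>R. \<alpha> i * x i)"
    using fin P \<alpha>0 by (intro sum.mono_neutral_left) auto
  also have "(1 - 1 / real (card P)) * (\<Sum>i\<in>R. \<alpha> i * x i)\<^sup>2 \<le> (1 - 1 / real (card R)) * (\<Sum>i\<in>R. \<alpha> i * x i)\<^sup>2"
  \<comment> \<open>For empty \<open>P\<close> the factor on the left is
    \<open>1 - 1 / 0 = 1\<close>, which exceeds the right one; then the sum itself is zero.\<close>
  proof (cases "P = {}")
    case True
    then have "(\<Sum>i\<in>R. \<alpha> i * x i) = 0" using \<alpha>0 by (intro sum.neutral) auto
    then show ?thesis by simp
  next
    case False
    then have "0 < card P" "card P \<le> card R" using P fin by (auto simp: card_gt_0_iff card_mono)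
    then show ?thesis by (intro mult_right_mono) (auto simp: frac_le)
  qed
  finally show ?thesis .
qed

text \<open>The case where the empty set has weight zero. On indices with positive
  \<open>\<alpha>\<close> the ultrametric bound is a multiple of the squared linear form, hence
  zero. The block of the other indices \<open>Z\<close> vanishes, and their entries against
  \<open>P\<close> are proportional to \<open>\<alpha>\<close>, so they only contribute multiples of
  the linear form.\<close>

lemma offdiag_form_nonpos:
  assumes fin: "finite R" and sym: "\<And>i j. i \<in> R \<Longrightarrow> j \<in> R \<Longrightarrow> \<beta> i j = \<beta> j i"
    and nonneg: "\<And>i j. i \<in> R \<Longrightarrow> j \<in> R \<Longrightarrow> 0 \<le> \<beta> i j"
    and \<alpha>: "\<And>i. i \<in> R \<Longrightarrow> 0 \<le> \<alpha> i" and k0: "k0 \<in> R" "0 < \<alpha> k0"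
    and exch: "\<And>i j k. i \<in> R \<Longrightarrow> j \<in> R \<Longrightarrow> k \<in> R \<Longrightarrow> i \<noteq> j \<Longrightarrow> i \<noteq> k \<Longrightarrow> j \<noteq> k \<Longrightarrow>
        \<alpha> k * \<beta> i j \<le> max (\<alpha> i * \<beta> j k) (\<alpha> j * \<beta> i k)"
    and L: "(\<Sum>i\<in>R. \<alpha> i * x i) = 0"
  shows "bil R (offdiag \<beta>) x x \<le> 0"
proof -
  define P where "P = {i \<in> R. 0 < \<alpha> i}"
  define Z where "Z = R - P"
  have PZ: "P \<subseteq> R" "finite P" "finite Z" "P \<inter> Z = {}" "R = P \<union> Z"
    using fin by (auto simp: P_def Z_def)
  have \<alpha>0: "\<alpha> i = 0" if "i \<in> Z" for i using that \<alpha>[of i] by (auto simp: P_def Z_def)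
  have LP: "(\<Sum>i\<in>P. \<alpha> i * x i) = 0"
    using L PZ \<alpha>0 by (simp add: sum.union_disjoint)
  define \<kappa> where "\<kappa> i = \<beta> i k0 / \<alpha> k0" for i
  have k0P: "k0 \<in> P" using k0 by (simp add: P_def)
  have cross: "offdiag \<beta> i j = \<kappa> i * \<alpha> j" if "i \<in> Z" "j \<in> P" for i j
  proof (cases "j = k0")
    case False
    have "i \<in> R" "j \<in> R" "i \<noteq> j" "i \<noteq> k0" using that PZ k0P by blast+
    \<comment> \<open>With \<open>\<alpha> i = 0\<close> each of two instances of the exchange loses
      one alternative, and they give opposite inequalities.\<close>
    then have "\<alpha> k0 * \<beta> i j \<le> max 0 (\<alpha> j * \<beta> i k0)" "\<alpha> j * \<beta> i k0 \<le> max 0 (\<alpha> k0 * \<beta> i j)"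
      using exch[of i j k0] exch[of i k0 j] k0 False \<alpha>0[OF that(1)] by auto
    then have "\<alpha> k0 * \<beta> i j = \<alpha> j * \<beta> i k0"
      using nonneg[of i j] nonneg[of i k0] \<alpha>[of j] k0 \<open>i \<in> R\<close> \<open>j \<in> R\<close> by (simp add: max_def)
    then show ?thesis using k0 \<open>i \<noteq> j\<close> by (simp add: offdiag_def \<kappa>_def field_simps)
  next
    case True
    then have "i \<noteq> j" using that PZ by blast
    then show ?thesis using True k0 by (simp add: offdiag_def \<kappa>_def)
  qed
  have ZZ: "offdiag \<beta> i j = 0" if "i \<in> Z" "j \<in> Z" for i j
  proof (cases "i = j")
    case False
    have "i \<in> R" "j \<in> R" "i \<noteq> k0" "j \<noteq> k0" using that PZ k0P by blast+
    then have "\<alpha> k0 * \<beta> i j \<le> 0"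
      using exch[of i j k0] k0(1) False \<alpha>0[OF that(1)] \<alpha>0[OF that(2)] by simp
    then show ?thesis
      using k0 nonneg[OF \<open>i \<in> R\<close> \<open>j \<in> R\<close>] by (auto simp: mult_le_0_iff offdiag_def)
  qed (simp add: offdiag_def)
  have "bil R (offdiag \<beta>) x x = bil P (offdiag \<beta>) x x + bil Z (offdiag \<beta>) x x
      + 2 * (\<Sum>i\<in>Z. \<Sum>j\<in>P. x i * offdiag \<beta> i j * x j)"
    unfolding PZ(5)
  proof (rule bil_Un)
    show "offdiag \<beta> i j = offdiag \<beta> j i" if "i \<in> P \<union> Z" "j \<in> P \<union> Z" for i j
      unfolding offdiag_def using sym[of i j] that PZ(5) by auto
  qed (use PZ in auto)
  also have "bil Z (offdiag \<beta>) x x = 0" by (simp add: bil_def ZZ)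
  also have "(\<Sum>i\<in>Z. \<Sum>j\<in>P. x i * offdiag \<beta> i j * x j) = (\<Sum>i\<in>Z. x i * \<kappa> i * (\<Sum>j\<in>P. \<alpha> j * x j))"
    by (simp add: cross sum_distrib_left mult_ac)
  also have "\<dots> = 0" by (simp add: LP)
  \<comment> \<open>Any finite bound for the rescaled entries serves, since it is multiplied by
    zero; the sum of all of them is one.\<close>
  also have "bil P (offdiag \<beta>) x x
      \<le> (\<Sum>i\<in>P. \<Sum>j\<in>P. \<beta> i j / (\<alpha> i * \<alpha> j)) * (1 - 1 / real (card P)) * (\<Sum>i\<in>P. \<alpha> i * x i)\<^sup>2"
  proof (rule weighted_ultrametric_form_le)
    have t: "0 \<le> \<beta> i j / (\<alpha> i * \<alpha> j)" if "i \<in> P" "j \<in> P" for i j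
      using that nonneg[of i j] by (auto simp: P_def)
    show "\<beta> i j = \<beta> j i" if "i \<in> P" "j \<in> P" for i j
      by (rule sym) (use that PZ in auto)
    show "0 \<le> \<beta> i j" if "i \<in> P" "j \<in> P" for i j
      by (rule nonneg) (use that PZ in auto)
    show "\<alpha> k * \<beta> i j \<le> max (\<alpha> i * \<beta> j k) (\<alpha> j * \<beta> i k)"
      if "i \<in> P" "j \<in> P" "k \<in> P" "i \<noteq> j" "i \<noteq> k" "j \<noteq> k" for i j k
      using that PZ by (intro exch) auto
    show "0 \<le> (\<Sum>i\<in>P. \<Sum>j\<in>P. \<beta> i j / (\<alpha> i * \<alpha> j))" using t by (intro sum_nonneg)
    show "\<beta> i j \<le> (\<Sum>i\<in>P. \<Sum>j\<in>P. \<beta> i j / (\<alpha> i * \<alpha> j)) * (\<alpha> i * \<alpha> j)"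
      if "i \<in> P" "j \<in> P" "i \<noteq> j" for i j
    proof -
      have "\<beta> i j / (\<alpha> i * \<alpha> j) \<le> (\<Sum>j\<in>P. \<beta> i j / (\<alpha> i * \<alpha> j))"
        using PZ t that by (intro member_le_sum[of j]) auto
      also have "\<dots> \<le> (\<Sum>i\<in>P. \<Sum>j\<in>P. \<beta> i j / (\<alpha> i * \<alpha> j))"
        using PZ t that by (intro member_le_sum[of i P "\<lambda>i. \<Sum>j\<in>P. \<beta> i j / (\<alpha> i * \<alpha> j)"] sum_nonneg) auto
      finally show ?thesis using that by (simp add: P_def pos_divide_le_eq)
    qed
  qed (use PZ(2) in \<open>auto simp: P_def\<close>)
  finally show ?thesis by (simp add: LP)
qed

lemma bil_insert_None:
  assumes "finite R" and "\<And>i j. i \<in> insert None (Some ` R) \<Longrightarrow> j \<in> insert None (Some ` R) \<Longrightarrow> M i j = M j i"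
  shows "bil (insert None (Some ` R)) M x x = M None None * (x None)\<^sup>2
    + 2 * x None * (\<Sum>i\<in>R. M None (Some i) * x (Some i))
    + bil R (\<lambda>i j. M (Some i) (Some j)) (\<lambda>i. x (Some i)) (\<lambda>i. x (Some i))"
proof -
  have "bil (Some ` R \<union> {None}) M x x = bil (Some ` R) M x x + bil {None} M x x
      + 2 * (\<Sum>i\<in>{None}. \<Sum>j\<in>Some ` R. x i * M i j * x j)"
    using assms by (intro bil_Un) auto
  moreover have "bil (Some ` R) M x x = bil R (\<lambda>i j. M (Some i) (Some j)) (\<lambda>i. x (Some i)) (\<lambda>i. x (Some i))"
    by (simp add: bil_def sum.reindex)
  ultimately show ?thesis
    by (simp add: bil_def sum.reindex sum_distrib_left power2_eq_square mult_ac)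
qed

text \<open>The coefficients \<open>n (n - 1)\<close> and \<open>n - 1\<close>, which come from the powers of \<open>y\<close>, are exactly what the
  constant \<open>1 - 1 / n\<close> in \<open>offdiag_form_le_square\<close> can absorb.\<close>

lemma lorentz_form_two_level:
  fixes M :: "'n option \<Rightarrow> 'n option \<Rightarrow> real"
  assumes fin: "finite R" and r: "2 \<le> card R" and c: "0 \<le> c"
    and sym: "\<And>i j. i \<in> R \<Longrightarrow> j \<in> R \<Longrightarrow> \<beta> i j = \<beta> j i"
    and nonneg: "\<And>i j. i \<in> R \<Longrightarrow> j \<in> R \<Longrightarrow> 0 \<le> \<beta> i j"
    and \<alpha>: "\<And>i. i \<in> R \<Longrightarrow> 0 \<le> \<alpha> i" and A: "0 \<le> A"
    and exch1: "\<And>i j. i \<in> R \<Longrightarrow> j \<in> R \<Longrightarrow> i \<noteq> j \<Longrightarrow> A * \<beta> i j \<le> \<alpha> i * \<alpha> j"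
    and exch2: "\<And>i j k. i \<in> R \<Longrightarrow> j \<in> R \<Longrightarrow> k \<in> R \<Longrightarrow> i \<noteq> j \<Longrightarrow> i \<noteq> k \<Longrightarrow> j \<noteq> k \<Longrightarrow>
        \<alpha> k * \<beta> i j \<le> max (\<alpha> i * \<beta> j k) (\<alpha> j * \<beta> i k)"
    and exch3: "\<And>p i j k. (\<And>i. i \<in> R \<Longrightarrow> \<alpha> i = 0) \<Longrightarrow>
        p \<in> R \<Longrightarrow> i \<in> R \<Longrightarrow> j \<in> R \<Longrightarrow> k \<in> R \<Longrightarrow> distinct [p, i, j, k] \<Longrightarrow>
        \<beta> p k * \<beta> i j \<le> max (\<beta> p i * \<beta> j k) (\<beta> p j * \<beta> i k)"
    and M0: "M None None = c * real (card R) * (real (card R) - 1) * A"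
    and M1: "\<And>i. i \<in> R \<Longrightarrow> M None (Some i) = c * (real (card R) - 1) * \<alpha> i"
      "\<And>i. i \<in> R \<Longrightarrow> M (Some i) None = c * (real (card R) - 1) * \<alpha> i"
    and M2: "\<And>i j. i \<in> R \<Longrightarrow> j \<in> R \<Longrightarrow> M (Some i) (Some j) = c * offdiag \<beta> i j"
  shows "lorentz_form (insert None (Some ` R)) M"
proof -
  let ?I = "insert None (Some ` R)" and ?r = "real (card R)"
  have Msym: "M i j = M j i" if "i \<in> ?I" "j \<in> ?I" for i j
  proof -
    have "offdiag \<beta> i j = offdiag \<beta> j i" if "i \<in> R" "j \<in> R" for i j
      using sym[OF that] by (simp add: offdiag_def)
    then show ?thesis using that M1 M2 by auto
  qed
  have Mnn: "0 \<le> M i j" if "i \<in> ?I" "j \<in> ?I" for i j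
    using that M0 M1 M2 nonneg \<alpha> A c r by (auto simp: offdiag_def)
  have form: "bil ?I M x x = c * (?r * (?r - 1) * A * (x None)\<^sup>2
      + 2 * (?r - 1) * x None * (\<Sum>i\<in>R. \<alpha> i * x (Some i))
      + bil R (offdiag \<beta>) (\<lambda>i. x (Some i)) (\<lambda>i. x (Some i)))" for x
  proof -
    have "bil R (\<lambda>i j. M (Some i) (Some j)) (\<lambda>i. x (Some i)) (\<lambda>i. x (Some i))
        = c * bil R (offdiag \<beta>) (\<lambda>i. x (Some i)) (\<lambda>i. x (Some i))"
      by (simp add: bil_def M2 sum_distrib_left mult_ac)
    note s1 = this
    have s2: "(\<Sum>i\<in>R. M None (Some i) * x (Some i)) = c * (?r - 1) * (\<Sum>i\<in>R. \<alpha> i * x (Some i))"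
      by (simp add: M1 sum_distrib_left mult_ac)
    have "bil ?I M x x = M None None * (x None)\<^sup>2
        + 2 * x None * (\<Sum>i\<in>R. M None (Some i) * x (Some i))
        + bil R (\<lambda>i j. M (Some i) (Some j)) (\<lambda>i. x (Some i)) (\<lambda>i. x (Some i))"
      by (rule bil_insert_None[OF fin Msym])
    then show ?thesis unfolding s1 s2 M0 by (simp add: algebra_simps)
  qed
  have sum_I: "(\<Sum>i\<in>?I. f i) = f None + (\<Sum>i\<in>R. f (Some i))" for f :: "'n option \<Rightarrow> real"
    using fin by (simp add: sum.reindex)
  show ?thesis
  proof (cases "A = 0")
    case False
    then have A: "0 < A" using A by simp
    show ?thesis
    \<comment> \<open>\<open>l\<close> is row \<open>None\<close> of \<open>M\<close> up to a
      factor. On its kernel the terms with \<open>x None\<close> add up to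
      \<open>- ?r * (?r - 1) * A\<close> times the square of \<open>x None\<close>, times
      \<open>c\<close>, which is exactly what the ultrametric bound for the remaining block
      allows.\<close>
    proof (rule lorentz_formI[where l = "\<lambda>i. case i of None \<Rightarrow> ?r * A | Some i \<Rightarrow> \<alpha> i"])
      fix x :: "'n option \<Rightarrow> real"
      assume "(\<Sum>i\<in>?I. (case i of None \<Rightarrow> ?r * A | Some i \<Rightarrow> \<alpha> i) * x i) = 0"
      then have L: "(\<Sum>i\<in>R. \<alpha> i * x (Some i)) = - (?r * A * x None)" by (simp add: sum_I)
      have "A * bil R (offdiag \<beta>) (\<lambda>i. x (Some i)) (\<lambda>i. x (Some i))
          \<le> (1 - 1 / ?r) * (?r * A * x None)\<^sup>2"
      proof -
        have "A * bil R (offdiag \<beta>) (\<lambda>i. x (Some i)) (\<lambda>i. x (Some i))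
            \<le> (1 - 1 / ?r) * (\<Sum>i\<in>R. \<alpha> i * x (Some i))\<^sup>2"
          by (rule offdiag_form_le_square[OF fin]) (rule sym nonneg \<alpha> exch2 A exch1; assumption?)+
        then show ?thesis by (simp add: L)
      qed
      also have "\<dots> = A * (?r * (?r - 1) * A * (x None)\<^sup>2)"
        using r by (simp add: power2_eq_square field_simps)
      finally have "bil R (offdiag \<beta>) (\<lambda>i. x (Some i)) (\<lambda>i. x (Some i)) \<le> ?r * (?r - 1) * A * (x None)\<^sup>2"
        using A by simp
      then have "?r * (?r - 1) * A * (x None)\<^sup>2 + 2 * (?r - 1) * x None * (\<Sum>i\<in>R. \<alpha> i * x (Some i))
          + bil R (offdiag \<beta>) (\<lambda>i. x (Some i)) (\<lambda>i. x (Some i)) \<le> 0"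
        by (simp add: L power2_eq_square algebra_simps)
      then show "bil ?I M x x \<le> 0" unfolding form using c by (simp add: mult_nonneg_nonpos)
    qed (rule Msym Mnn; assumption)+
  next
    case A0: True
    show ?thesis
    proof (cases "\<exists>k\<in>R. 0 < \<alpha> k")
      case True
      then obtain k where k: "k \<in> R" "0 < \<alpha> k" by blast
      show ?thesis
      \<comment> \<open>Again row \<open>None\<close> up to a factor, now with
        \<open>A = 0\<close>.\<close>
      proof (rule lorentz_formI[where l = "\<lambda>i. case i of None \<Rightarrow> 0 | Some i \<Rightarrow> \<alpha> i"])
        fix x :: "'n option \<Rightarrow> real"
        assume "(\<Sum>i\<in>?I. (case i of None \<Rightarrow> 0 | Some i \<Rightarrow> \<alpha> i) * x i) = 0"
        then have L: "(\<Sum>i\<in>R. \<alpha> i * x (Some i)) = 0" by (simp add: sum_I)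
        have "bil R (offdiag \<beta>) (\<lambda>i. x (Some i)) (\<lambda>i. x (Some i)) \<le> 0"
          by (rule offdiag_form_nonpos[OF fin _ _ _ k _ L]) (rule sym nonneg \<alpha> exch2; assumption)+
        then show "bil ?I M x x \<le> 0" unfolding form using c by (simp add: L A0 mult_nonneg_nonpos)
      qed (rule Msym Mnn; assumption)+
    next
      case False
      then have \<alpha>0: "\<alpha> i = 0" if "i \<in> R" for i using that \<alpha>[of i] by force
      have form': "bil ?I M x x = c * bil R (offdiag \<beta>) (\<lambda>i. x (Some i)) (\<lambda>i. x (Some i))" for x
        by (simp add: form A0 \<alpha>0)
      show ?thesis
      proof (cases "\<exists>p\<in>R. \<exists>k\<in>R. p \<noteq> k \<and> 0 < \<beta> p k")
        case True
        then obtain p k where pk: "p \<in> R" "k \<in> R" "p \<noteq> k" "0 < \<beta> p k" by blast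
        define R' where "R' = R - {p}"
        have R': "finite R'" "R = R' \<union> {p}" "R' \<inter> {p} = {}" "R' \<subseteq> R" "k \<in> R'" using fin pk by (auto simp: R'_def)
        show ?thesis
        \<comment> \<open>Only the block \<open>\<beta>\<close> is left. Row \<open>p\<close> takes
          over the role of \<open>\<alpha>\<close> on \<open>R - {p}\<close>: \<open>exch3\<close>
          is the exchange inequality for it, and on the kernel of the row the terms with
          \<open>x (Some p)\<close> vanish.\<close>
        proof (rule lorentz_formI[where l = "\<lambda>i. case i of None \<Rightarrow> 0 | Some i \<Rightarrow> offdiag \<beta> p i"])
          fix x :: "'n option \<Rightarrow> real"
          assume "(\<Sum>i\<in>?I. (case i of None \<Rightarrow> 0 | Some i \<Rightarrow> offdiag \<beta> p i) * x i) = 0"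
          then have "(\<Sum>i\<in>R' \<union> {p}. offdiag \<beta> p i * x (Some i)) = 0"
            by (simp only: sum_I R'(2)[symmetric]) simp
          then have L: "(\<Sum>i\<in>R'. offdiag \<beta> p i * x (Some i)) = 0"
            using R' by (subst (asm) sum.union_disjoint) (auto simp: offdiag_def)
          moreover have "(\<Sum>i\<in>R'. offdiag \<beta> p i * x (Some i)) = (\<Sum>i\<in>R'. \<beta> p i * x (Some i))"
            by (intro sum.cong) (auto simp: offdiag_def R'_def)
          ultimately have L': "(\<Sum>i\<in>R'. \<beta> p i * x (Some i)) = 0" by simp
          have "bil (R' \<union> {p}) (offdiag \<beta>) (\<lambda>i. x (Some i)) (\<lambda>i. x (Some i))
            = bil R' (offdiag \<beta>) (\<lambda>i. x (Some i)) (\<lambda>i. x (Some i))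
              + bil {p} (offdiag \<beta>) (\<lambda>i. x (Some i)) (\<lambda>i. x (Some i))
              + 2 * (\<Sum>i\<in>{p}. \<Sum>j\<in>R'. x (Some i) * offdiag \<beta> i j * x (Some j))"
          proof (rule bil_Un)
            show "offdiag \<beta> i j = offdiag \<beta> j i" if "i \<in> R' \<union> {p}" "j \<in> R' \<union> {p}" for i j
              unfolding offdiag_def using sym[of i j] that R'(2) by auto
          qed (use R' in auto)
          also have "(\<Sum>i\<in>{p}. \<Sum>j\<in>R'. x (Some i) * offdiag \<beta> i j * x (Some j)) =
              x (Some p) * (\<Sum>j\<in>R'. offdiag \<beta> p j * x (Some j))"
            by (simp add: sum_distrib_left mult_ac)
          also have "bil {p} (offdiag \<beta>) (\<lambda>i. x (Some i)) (\<lambda>i. x (Some i)) = 0"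
            by (simp add: bil_def offdiag_def)
          finally have "bil R (offdiag \<beta>) (\<lambda>i. x (Some i)) (\<lambda>i. x (Some i))
            = bil R' (offdiag \<beta>) (\<lambda>i. x (Some i)) (\<lambda>i. x (Some i))"
            by (simp only: R'(2)[symmetric] L mult_zero_right add_0_right)
          also have "\<dots> \<le> 0"
          proof (rule offdiag_form_nonpos[where \<alpha> = "\<beta> p" and ?k0.0 = k])
            show "\<beta> i j = \<beta> j i" if "i \<in> R'" "j \<in> R'" for i j
              by (rule sym) (use that R'(4) in auto)
            show "0 \<le> \<beta> i j" if "i \<in> R'" "j \<in> R'" for i j
              by (rule nonneg) (use that R'(4) in auto)
            show "0 \<le> \<beta> p i" if "i \<in> R'" for i using that R' nonneg[of p i] pk by auto
            show "\<beta> p k * \<beta> i j \<le> max (\<beta> p i * \<beta> j k) (\<beta> p j * \<beta> i k)"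
              if "i \<in> R'" "j \<in> R'" "k \<in> R'" "i \<noteq> j" "i \<noteq> k" "j \<noteq> k" for i j k
              using that pk by (intro exch3 \<alpha>0) (auto simp: R'_def)
          qed (use R'(1,5) L' pk in auto)
          finally show "bil ?I M x x \<le> 0" unfolding form' using c by (simp add: mult_nonneg_nonpos)
        qed (rule Msym Mnn; assumption)+
      next
        case False
        then have "offdiag \<beta> i j = 0" if "i \<in> R" "j \<in> R" for i j
          using that nonneg[of i j] by (force simp: offdiag_def)
        then have "bil ?I M x x \<le> 0" for x unfolding form' by (simp add: bil_def)
        then show ?thesis using Msym Mnn by (intro lorentz_formI) auto
      qed
    qed
  qed
qed

section \<open>Set functions with the multiplicative exchange property\<close>

definition exp_M_natural :: "'n set \<Rightarrow> ('n set \<Rightarrow> real) \<Rightarrow> bool" where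
  "exp_M_natural N a \<longleftrightarrow> (\<forall>S. S \<subseteq> N \<longrightarrow> 0 \<le> a S) \<and>
     (\<forall>S T. S \<subseteq> N \<longrightarrow> T \<subseteq> N \<longrightarrow> (\<forall>i\<in>S - T.
        a S * a T \<le> a (S - {i}) * a (insert i T) \<or>
        (\<exists>j\<in>T - S. a S * a T \<le> a (insert j (S - {i})) * a (insert i (T - {j})))))"

lemma exp_M_natural_nonneg: "exp_M_natural N a \<Longrightarrow> S \<subseteq> N \<Longrightarrow> 0 \<le> a S"
  by (simp add: exp_M_natural_def)

lemma exp_M_natural_exchange:
  assumes "exp_M_natural N a" "S \<subseteq> N" "T \<subseteq> N" "i \<in> S" "i \<notin> T"
  obtains "a S * a T \<le> a (S - {i}) * a (insert i T)"
  | j where "j \<in> T" "j \<notin> S" "a S * a T \<le> a (insert j (S - {i})) * a (insert i (T - {j}))"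
proof -
  have "\<forall>i\<in>S - T. a S * a T \<le> a (S - {i}) * a (insert i T) \<or>
      (\<exists>j\<in>T - S. a S * a T \<le> a (insert j (S - {i})) * a (insert i (T - {j})))"
    using assms(1)[unfolded exp_M_natural_def, THEN conjunct2] assms(2,3) by simp
  then show thesis using assms(4,5) that by blast
qed

text \<open>Contraction by \<open>A\<close> is what differentiation by all \<open>w i\<close> with
  \<open>i \<in> A\<close> does to the coefficients.\<close>

lemma exp_M_natural_contract:
  assumes "exp_M_natural N a" "A \<subseteq> N"
  shows "exp_M_natural (N - A) (\<lambda>S. a (A \<union> S))"
  unfolding exp_M_natural_def
proof (intro conjI allI impI ballI)
  show "0 \<le> a (A \<union> S)" if "S \<subseteq> N - A" for S
    using assms that by (intro exp_M_natural_nonneg[OF assms(1)]) auto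
  fix S T i assume *: "S \<subseteq> N - A" "T \<subseteq> N - A" "i \<in> S - T"
  have e: "A \<union> S - {i} = A \<union> (S - {i})" "insert i (A \<union> T) = A \<union> insert i T"
    using * by auto
  have sub: "A \<union> S \<subseteq> N" "A \<union> T \<subseteq> N" "i \<in> A \<union> S" "i \<notin> A \<union> T" using * assms by auto
  from exp_M_natural_exchange[OF assms(1) sub]
  show "a (A \<union> S) * a (A \<union> T) \<le> a (A \<union> (S - {i})) * a (A \<union> insert i T) \<or>
      (\<exists>j\<in>T - S. a (A \<union> S) * a (A \<union> T) \<le> a (A \<union> insert j (S - {i})) * a (A \<union> insert i (T - {j})))"
  proof cases
    case 1
    then show ?thesis unfolding e by blast
  next
    case (2 j)
    then have j: "j \<in> T - S" using * by blast
    have "insert j (A \<union> S - {i}) = A \<union> insert j (S - {i})"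
      "insert i (A \<union> T - {j}) = A \<union> insert i (T - {j})" using * j by auto
    then have "a (A \<union> S) * a (A \<union> T) \<le> a (A \<union> insert j (S - {i})) * a (A \<union> insert i (T - {j}))"
      using 2(3) by (simp only:)
    then show ?thesis using j by blast
  qed
qed

definition hvalid :: "'n set \<Rightarrow> 'n option multiset \<Rightarrow> bool" where
  "hvalid N \<alpha> \<longleftrightarrow> (\<forall>i. count \<alpha> (Some i) \<le> 1) \<and> {i. Some i \<in># \<alpha>} \<subseteq> N"

text \<open>\<open>hcoeff N a \<alpha>\<close> is the \<open>\<alpha>\<close>-th partial derivative of the homogeneous polynomial
  \<open>\<Sum>S \<subseteq> N. a S * w\<^sup>S * y\<^bsup>card N - card S\<^esup>\<close>, where \<open>Some i\<close> stands for the
  variable \<open>w i\<close> and \<open>None\<close> for \<open>y\<close>; it is only used for \<open>size \<alpha> = card N\<close>.\<close>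

definition hcoeff :: "'n set \<Rightarrow> ('n set \<Rightarrow> real) \<Rightarrow> 'n option multiset \<Rightarrow> real" where
  "hcoeff N a \<alpha> = (if hvalid N \<alpha> then fact (count \<alpha> None) * a {i. Some i \<in># \<alpha>} else 0)"

lemma hvalid_add_None [simp]: "hvalid N (add_mset None \<alpha>) \<longleftrightarrow> hvalid N \<alpha>"
  by (simp add: hvalid_def)

lemma hvalid_add_Some [simp]:
  "hvalid N (add_mset (Some i) \<alpha>) \<longleftrightarrow> hvalid N \<alpha> \<and> i \<in> N \<and> Some i \<notin># \<alpha>"
proof -
  have "(\<forall>j. count (add_mset (Some i) \<alpha>) (Some j) \<le> 1) \<longleftrightarrow>
      (\<forall>j. count \<alpha> (Some j) \<le> 1) \<and> count \<alpha> (Some i) = 0"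
  proof (intro iffI conjI allI)
    assume L: "\<forall>j. count (add_mset (Some i) \<alpha>) (Some j) \<le> 1"
    show "count \<alpha> (Some i) = 0" using L[rule_format, of i] by simp
    show "count \<alpha> (Some j) \<le> 1" for j using L[rule_format, of j] by (simp split: if_splits)
  qed auto
  then show ?thesis by (auto simp: hvalid_def not_in_iff)
qed

lemma supp_add_None: "{i. Some i \<in># add_mset None \<alpha>} = {i. Some i \<in># \<alpha>}"
  by simp

lemma supp_add_Some: "{j. Some j \<in># add_mset (Some i) \<alpha>} = insert i {j. Some j \<in># \<alpha>}"
  by auto

lemma size_hvalid:
  assumes "finite N" "hvalid N \<alpha>"
  shows "size \<alpha> = count \<alpha> None + card {i. Some i \<in># \<alpha>}"
  using assms(2)
proof (induction \<alpha>)
  case (add x \<alpha>)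
  show ?case
  proof (cases x)
    case (Some i)
    then have "hvalid N \<alpha>" "i \<notin> {j. Some j \<in># \<alpha>}" using add.prems by auto
    moreover have "finite {j. Some j \<in># \<alpha>}"
      using \<open>hvalid N \<alpha>\<close> assms(1) finite_subset unfolding hvalid_def by blast
    ultimately show ?thesis using add.IH unfolding Some supp_add_Some by simp
  qed (use add in simp)
qed simp

lemma hcoeff_nonneg: "exp_M_natural N a \<Longrightarrow> 0 \<le> hcoeff N a \<alpha>"
  by (simp add: hcoeff_def hvalid_def exp_M_natural_nonneg)

text \<open>The Hessians of the quadratic partial derivatives. With \<open>A\<close> the set of
  \<open>w\<close> variables in \<open>\<beta>\<close> and \<open>p\<close> the number of
  \<open>None\<close>, only sets of size at most two over \<open>A\<close> matter.\<close>

lemma lorentz_form_hcoeff: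
  fixes a :: "'n set \<Rightarrow> real"
  assumes fin: "finite N" and a: "exp_M_natural N a" and size: "size \<beta> + 2 = card N"
  shows "lorentz_form (insert None (Some ` N)) (\<lambda>i j. hcoeff N a (add_mset i (add_mset j \<beta>)))"
proof (cases "hvalid N \<beta>")
  case False
  then have "hcoeff N a (add_mset i (add_mset j \<beta>)) = 0" for i j
    by (cases i; cases j) (simp_all add: hcoeff_def)
  then show ?thesis by (intro lorentz_formI) (simp_all add: bil_def)
next
  case True
  define A where "A = {i. Some i \<in># \<beta>}"
  define R where "R = N - A"
  define b where "b S = a (A \<union> S)" for S
  define p where "p = count \<beta> None"
  have AN: "A \<subseteq> N" using True by (simp add: A_def hvalid_def)
  have b: "exp_M_natural R b" unfolding R_def b_def by (rule exp_M_natural_contract[OF a AN])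
  have nn: "0 \<le> b S" if "S \<subseteq> R" for S using exp_M_natural_nonneg[OF b that] .
  have "card A + p + 2 = card N"
    using size_hvalid[OF fin True] size by (simp add: A_def p_def)
  \<comment> \<open>Source of the coefficients: \<open>(p + 1)!\<close> and \<open>(p + 2)!\<close>
    are \<open>p!\<close> times \<open>card R - 1\<close> and
    \<open>card R * (card R - 1)\<close>.\<close>
  then have cR: "card R = p + 2" using AN finite_subset[OF AN fin] by (simp add: R_def card_Diff_subset)
  have finR: "finite R" using fin by (simp add: R_def)
  have memA: "Some i \<in># \<beta> \<longleftrightarrow> i \<in> A" for i by (simp add: A_def)
  let ?M = "\<lambda>i j. hcoeff N a (add_mset i (add_mset j \<beta>))"
  have M2: "?M (Some i) (Some j) = fact p * offdiag (\<lambda>i j. b {i, j}) i j" if "i \<in> R" "j \<in> R" for i j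
  proof (cases "i = j")
    case False
    then have "?M (Some i) (Some j) = fact p * a (insert i (insert j A))"
      using that True unfolding hcoeff_def supp_add_Some by (auto simp: R_def memA p_def A_def[symmetric])
    also have "insert i (insert j A) = A \<union> {i, j}" by auto
    finally show ?thesis using False by (simp add: b_def offdiag_def)
  qed (simp add: hcoeff_def offdiag_def)
  have M1: "?M None (Some i) = fact p * (real (card R) - 1) * b {i}"
    "?M (Some i) None = fact p * (real (card R) - 1) * b {i}" if "i \<in> R" for i
  proof -
    have "?M None (Some i) = fact (Suc p) * a (insert i A)"
      using that True unfolding hcoeff_def supp_add_Some supp_add_None
      by (auto simp: R_def memA p_def A_def[symmetric])
    then show "?M None (Some i) = fact p * (real (card R) - 1) * b {i}"
      by (simp add: b_def cR algebra_simps)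
    then show "?M (Some i) None = fact p * (real (card R) - 1) * b {i}"
      by (simp add: add_mset_commute)
  qed
  have M0: "?M None None = fact p * real (card R) * (real (card R) - 1) * b {}"
    using True unfolding hcoeff_def supp_add_None
    by (simp add: A_def[symmetric] p_def[symmetric] b_def cR algebra_simps)
  have zero: "?M i j = 0"
    if "i \<in> insert None (Some ` N)" "j \<in> insert None (Some ` N)"
      "i \<notin> insert None (Some ` R) \<or> j \<notin> insert None (Some ` R)" for i j
    using that by (cases i; cases j) (auto simp: hcoeff_def R_def memA)
  have "lorentz_form (insert None (Some ` R)) ?M"
  proof (rule lorentz_form_two_level[where A = "b {}" and \<alpha> = "\<lambda>i. b {i}" and \<beta> = "\<lambda>i j. b {i, j}"
        and c = "fact p", OF finR])
    \<comment> \<open>Exchange against the empty set: there is nothing to swap back, so only the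
      first alternative remains.\<close>
    show "b {} * b {i, j} \<le> b {i} * b {j}" if "i \<in> R" "j \<in> R" "i \<noteq> j" for i j
    proof (rule exp_M_natural_exchange[OF b, of "{i, j}" "{}" i])
      assume "b {i, j} * b {} \<le> b ({i, j} - {i}) * b {i}"
      moreover have "{i, j} - {i} = {j}" using that by auto
      ultimately show ?thesis by (simp add: mult.commute)
    qed (use that in auto)
    show "b {k} * b {i, j} \<le> max (b {i} * b {j, k}) (b {j} * b {i, k})"
      if "i \<in> R" "j \<in> R" "k \<in> R" "i \<noteq> j" "i \<noteq> k" "j \<noteq> k" for i j k
    proof -
      have e: "{i, j} - {i} = {j}" using that by auto
      show ?thesis
      proof (rule exp_M_natural_exchange[OF b, of "{i, j}" "{k}" i])
        assume "b {i, j} * b {k} \<le> b ({i, j} - {i}) * b {i, k}"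
        then show ?thesis by (simp add: e le_max_iff_disj mult.commute)
      next
        fix l assume "l \<in> {k}"
          "b {i, j} * b {k} \<le> b (insert l ({i, j} - {i})) * b (insert i ({k} - {l}))"
        then have "b {i, j} * b {k} \<le> b {k, j} * b {i}" by (simp add: e)
        also have "{k, j} = {j, k}" by blast
        finally show ?thesis by (simp add: le_max_iff_disj mult.commute)
      qed (use that in auto)
    qed
    show "b {p, k} * b {i, j} \<le> max (b {p, i} * b {j, k}) (b {p, j} * b {i, k})"
      if z: "\<And>i. i \<in> R \<Longrightarrow> b {i} = 0" and "p \<in> R" "i \<in> R" "j \<in> R" "k \<in> R" "distinct [p, i, j, k]"
      for p i j k
    proof -
      have e: "{p, k} - {p} = {k}" "{i, j} - {i} = {j}" "{i, j} - {j} = {i}"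
        using that by auto
      show ?thesis
      proof (rule exp_M_natural_exchange[OF b, of "{p, k}" "{i, j}" p])
        assume "b {p, k} * b {i, j} \<le> b ({p, k} - {p}) * b {p, i, j}"
        \<comment> \<open>Moving \<open>p\<close> without a swap leaves a singleton, of weight zero
          here; otherwise the exchange is the three-term inequality of a valuated matroid of rank
          two.\<close>
        then have "b {p, k} * b {i, j} \<le> 0" by (simp add: e z[OF \<open>k \<in> R\<close>])
        also have "0 \<le> b {p, i} * b {j, k}" using that by (intro mult_nonneg_nonneg nn) auto
        finally show ?thesis by simp
      next
        fix l assume l: "l \<in> {i, j}"
          "b {p, k} * b {i, j} \<le> b (insert l ({p, k} - {p})) * b (insert p ({i, j} - {l}))"
        from l(1) consider "l = i" | "l = j" by blast
        then show ?thesis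
        proof cases
          case 1
          then have "insert l ({p, k} - {p}) = {i, k}" "insert p ({i, j} - {l}) = {p, j}" using that by auto
          with l(2) show ?thesis by (simp add: mult.commute)
        next
          case 2
          then have "insert l ({p, k} - {p}) = {j, k}" "insert p ({i, j} - {l}) = {p, i}" using that by auto
          with l(2) show ?thesis by (simp add: mult.commute)
        qed
      qed (use that in auto)
    qed
    show "b {i, j} = b {j, i}" for i j by (simp add: insert_commute)
    show "0 \<le> b {i, j}" if "i \<in> R" "j \<in> R" for i j using that by (intro nn) simp
    show "0 \<le> b {i}" if "i \<in> R" for i using that by (intro nn) simp
    show "0 \<le> b {}" by (intro nn) simp
    show "2 \<le> card R" by (simp add: cR)
  qed (rule M0 M1 M2 fact_ge_zero; assumption?)+
  note L = this
  have sub: "insert None (Some ` R) \<subseteq> insert None (Some ` N)" by (auto simp: R_def)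
  show ?thesis
    by (rule iffD2[OF lorentz_form_mono_neutral[OF _ sub] L]) (use fin zero in blast)+
qed

text \<open>\<open>avail D S\<close> lists the variables that occur in the monomial \<open>w\<^sup>S * y\<^bsup>D - card S\<^esup>\<close>.\<close>

definition avail :: "nat \<Rightarrow> 'n set \<Rightarrow> 'n option set" where
  "avail D S = Some ` S \<union> (if card S < D then {None} else {})"

text \<open>Monomials sharing a variable force equal values of \<open>z\<close>, and two sets
  smaller than \<open>D\<close> share \<open>y\<close>. For disjoint sets, an exchange of one
  element yields a monomial of positive weight linking the two; \<open>2 \<le> D\<close> ensures
  that a set of size \<open>D\<close> keeps an element after the exchange.\<close>

lemma exp_M_natural_connected:
  fixes z :: "'n option \<Rightarrow> real"
  assumes fin: "finite R" and b: "exp_M_natural R b" and D: "2 \<le> D"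
    and z: "\<And>S j k. S \<subseteq> R \<Longrightarrow> card S \<le> D \<Longrightarrow> 0 < b S \<Longrightarrow> j \<in> avail D S \<Longrightarrow> k \<in> avail D S \<Longrightarrow> z j = z k"
    and S: "S \<subseteq> R" "card S \<le> D" "0 < b S" "j \<in> avail D S"
    and T: "T \<subseteq> R" "card T \<le> D" "0 < b T" "k \<in> avail D T"
  shows "z j = z k"
proof -
  have nn: "0 \<le> b S" if "S \<subseteq> R" for S using exp_M_natural_nonneg[OF b that] .
  have pos: "0 < b S'" "0 < b T'"
    if "b S * b T \<le> b S' * b T'" "0 < b S" "0 < b T" "S' \<subseteq> R" "T' \<subseteq> R" for S T S' T'
  proof -
    have "0 < b S * b T" by (rule mult_pos_pos) (fact that)+
    also note that(1)
    finally have "0 < b S' * b T'" .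
    then show "0 < b S'" "0 < b T'"
      using nn[OF that(4)] nn[OF that(5)] by (auto simp: zero_less_mult_iff)
  qed
  have meet: "z j = z k"
    if "S \<subseteq> R" "card S \<le> D" "0 < b S" "j \<in> avail D S"
      "T \<subseteq> R" "card T \<le> D" "0 < b T" "k \<in> avail D T" "l \<in> avail D S" "l \<in> avail D T" for S T j k l
    using z[of S j l] z[of T l k] that by simp
  have lt: "z j = z k"
    if S: "S \<subseteq> R" "card S < D" "0 < b S" "j \<in> avail D S"
      and T: "T \<subseteq> R" "card T = D" "0 < b T" "k \<in> avail D T" for S T j k
  proof (cases "S \<inter> T = {}")
    case False
    then obtain l where "l \<in> S" "l \<in> T" by blast
    then show ?thesis using S T by (intro meet[of S j T k "Some l"]) (auto simp: avail_def)
  next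
    case disj: True
    have finST: "finite S" "finite T" using S T fin finite_subset by auto
    obtain t1 t2 where t: "t1 \<in> T" "t2 \<in> T" "t1 \<noteq> t2"
      using T(2) D by (metis card_le_Suc0_iff_eq finST(2) not_less_eq_eq numeral_2_eq_2)
    from disj t have "t1 \<notin> S" by blast
    from exp_M_natural_exchange[OF b T(1) S(1) t(1) this] show ?thesis
    proof cases
      case 1
      have U: "insert t1 S \<subseteq> R" "card (insert t1 S) \<le> D" "0 < b (insert t1 S)"
        using pos[OF 1 T(3) S(3)] S T t finST \<open>t1 \<notin> S\<close> by auto
      \<comment> \<open>A common variable of the two monomials: an element of \<open>S\<close>, or
        \<open>y\<close> if \<open>S\<close> is empty, because then \<open>insert t1 S\<close> has
        size \<open>1 < D\<close>.\<close>
      obtain l where l: "l \<in> avail D S" "l \<in> avail D (insert t1 S)"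
      proof (cases "S = {}")
        case True
        then show ?thesis using D by (intro that[of None]) (auto simp: avail_def)
      next
        case False
        then obtain s where "s \<in> S" by blast
        then show ?thesis by (intro that[of "Some s"]) (auto simp: avail_def)
      qed
      have "z j = z (Some t1)"
        using S U l by (intro meet[of S j "insert t1 S" _ l]) (auto simp: avail_def)
      also have "\<dots> = z k" using T t by (intro z[of T]) (auto simp: avail_def)
      finally show ?thesis .
    next
      case (2 s)
      have "insert s (T - {t1}) \<subseteq> R" "insert t1 (S - {s}) \<subseteq> R" using S T 2 t by auto
      then have U: "insert s (T - {t1}) \<subseteq> R" "0 < b (insert s (T - {t1}))"
        "card (insert s (T - {t1})) \<le> D"
        using pos[OF 2(3) T(3) S(3)] card_Suc_Diff1[OF finST(2) t(1)] 2 T finST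
        by (auto simp: card_insert_if simp del: card_Diff_insert)
      have "z j = z (Some s)" using S 2 by (intro z[of S]) (auto simp: avail_def)
      also have "\<dots> = z (Some t2)"
        using U t by (intro z[of "insert s (T - {t1})"]) (auto simp: avail_def)
      also have "\<dots> = z k" using T t by (intro z[of T]) (auto simp: avail_def)
      finally show ?thesis .
    qed
  qed
  have finST: "finite S" "finite T" using S T fin finite_subset by auto
  consider "card S < D" "card T < D" | "card S < D" "card T = D" | "card S = D" "card T < D"
    | l where "l \<in> S" "l \<in> T" | "card S = D" "card T = D" "S \<inter> T = {}"
    using S(2) T(2) by fastforce
  then show ?thesis
  proof cases
    case 1
    then show ?thesis using S T by (intro meet[of S j T k None]) (auto simp: avail_def)
  next
    case 2
    then show ?thesis using lt[of S j T k] S T by blast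
  next
    case 3
    then show ?thesis using lt[of T k S j] S T by simp
  next
    case (4 l)
    then show ?thesis using S T by (intro meet[of S j T k "Some l"]) (auto simp: avail_def)
  next
    case 5
    obtain s1 s2 where s: "s1 \<in> S" "s2 \<in> S" "s1 \<noteq> s2"
      using 5(1) D by (metis card_le_Suc0_iff_eq finST(1) not_less_eq_eq numeral_2_eq_2)
    with 5 have "s1 \<notin> T" by blast
    from exp_M_natural_exchange[OF b S(1) T(1) s(1) this] show ?thesis
    proof cases
      case 1
      have U: "S - {s1} \<subseteq> R" "0 < b (S - {s1})" "card (S - {s1}) < D"
        using pos[OF 1 S(3) T(3)] S T s 5 finST D by (auto simp: card_Diff_singleton)
      have "z j = z (Some s2)" using S s by (intro z[of S]) (auto simp: avail_def)
      also have "\<dots> = z k" using U s T 5 by (intro lt[of "S - {s1}" _ T]) (auto simp: avail_def)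
      finally show ?thesis .
    next
      case (2 t)
      have "insert t (S - {s1}) \<subseteq> R" "insert s1 (T - {t}) \<subseteq> R" using S T 2 s by auto
      then have U: "insert t (S - {s1}) \<subseteq> R" "0 < b (insert t (S - {s1}))"
        "card (insert t (S - {s1})) \<le> D"
        using pos[OF 2(3) S(3) T(3)] card_Suc_Diff1[OF finST(1) s(1)] 2 S finST
        by (auto simp: card_insert_if simp del: card_Diff_insert)
      have "z j = z (Some s2)" using S s by (intro z[of S]) (auto simp: avail_def)
      also have "\<dots> = z (Some t)"
        using U s by (intro z[of "insert t (S - {s1})"]) (auto simp: avail_def)
      also have "\<dots> = z k" using T 2 by (intro z[of T]) (auto simp: avail_def)
      finally show ?thesis .
    qed
  qed
qed

lemma hvalid_add:
  assumes "hvalid N (\<alpha> + \<beta>)"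
  shows "hvalid N \<alpha>" "hvalid N \<beta>" "{i. Some i \<in># \<alpha>} \<inter> {i. Some i \<in># \<beta>} = {}"
proof -
  have c: "count \<alpha> (Some i) + count \<beta> (Some i) \<le> 1" for i
    using assms by (simp add: hvalid_def)
  have c': "count \<alpha> (Some i) \<le> 1" "count \<beta> (Some i) \<le> 1" for i
    using c[of i] by linarith+
  show "hvalid N \<alpha>" "hvalid N \<beta>"
    using assms c' by (auto simp: hvalid_def)
  have "\<not> (Some i \<in># \<alpha> \<and> Some i \<in># \<beta>)" for i
  proof
    assume "Some i \<in># \<alpha> \<and> Some i \<in># \<beta>"
    then have "0 < count \<alpha> (Some i)" "0 < count \<beta> (Some i)" by simp_all
    then show False using c[of i] by linarith
  qed
  then show "{i. Some i \<in># \<alpha>} \<inter> {i. Some i \<in># \<beta>} = {}" by blast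
qed

lemma hvalid_mset_set:
  assumes "finite S" "S \<subseteq> N" "hvalid N \<beta>" "S \<inter> {i. Some i \<in># \<beta>} = {}"
  shows "hvalid N (mset_set (Some ` S) + replicate_mset p None + \<beta>)"
  unfolding hvalid_def
proof (intro conjI allI)
  show "count (mset_set (Some ` S) + replicate_mset p None + \<beta>) (Some i) \<le> 1" for i
  proof (cases "i \<in> S")
    case True
    then have "Some i \<notin># \<beta>" using assms(4) by blast
    then show ?thesis using True assms(1) by (simp add: not_in_iff count_mset_set')
  next
    case False
    then show ?thesis using assms(1,3) by (simp add: count_mset_set' image_iff hvalid_def)
  qed
qed (use assms in \<open>auto simp: hvalid_def split: if_splits\<close>)

text \<open>\<open>\<beta>\<close> records the partial derivatives already taken, so that
  \<open>d\<close> is the remaining degree and every step of the induction concerns another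
  contraction of \<open>a\<close>.\<close>

lemma lorentzian_hcoeff:
  assumes fin: "finite N" and a: "exp_M_natural N a" and "2 \<le> d" and "size \<beta> + d = card N"
  shows "lorentzian (insert None (Some ` N)) d (\<lambda>\<alpha>. hcoeff N a (\<alpha> + \<beta>))"
  using assms(3,4)
proof (induction d arbitrary: \<beta> rule: nat_induct_at_least)
  case base
  show ?case
    unfolding lorentzian_def using lorentz_form_hcoeff[OF fin a base] by simp
next
  case (Suc d)
  let ?I = "insert None (Some ` N)"
  show ?case
  proof (rule lorentzian_SucI)
    show "lorentzian ?I d (\<lambda>\<alpha>. hcoeff N a (add_mset i \<alpha> + \<beta>))" for i
      using Suc.IH[of "add_mset i \<beta>"] Suc.prems by simp
    fix z :: "'a option \<Rightarrow> real" and \<alpha> \<alpha>' j k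
    assume z: "\<And>\<alpha> j k. size \<alpha> = Suc d \<Longrightarrow> set_mset \<alpha> \<subseteq> ?I \<Longrightarrow> 0 < hcoeff N a (\<alpha> + \<beta>) \<Longrightarrow>
          j \<in># \<alpha> \<Longrightarrow> k \<in># \<alpha> \<Longrightarrow> z j = z k"
      and \<alpha>: "size \<alpha> = Suc d" "0 < hcoeff N a (\<alpha> + \<beta>)" "j \<in># \<alpha>"
      and \<alpha>': "size \<alpha>' = Suc d" "0 < hcoeff N a (\<alpha>' + \<beta>)" "k \<in># \<alpha>'"
    define A where "A = {i. Some i \<in># \<beta>}"
    define R where "R = N - A"
    define b where "b S = a (A \<union> S)" for S
    have "hvalid N (\<alpha> + \<beta>)" using \<alpha>(2) by (simp add: hcoeff_def split: if_splits)
    note \<beta> = hvalid_add(2)[OF this]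
    have AN: "A \<subseteq> N" using \<beta> by (simp add: A_def hvalid_def)
    have b: "exp_M_natural R b" unfolding R_def b_def by (rule exp_M_natural_contract[OF a AN])
    have finR: "finite R" using fin by (simp add: R_def)
    have supp: "{i. Some i \<in># \<alpha>} \<subseteq> R \<and> card {i. Some i \<in># \<alpha>} \<le> Suc d \<and> 0 < b {i. Some i \<in># \<alpha>}
        \<and> j \<in> avail (Suc d) {i. Some i \<in># \<alpha>}"
      if "size \<alpha> = Suc d" "0 < hcoeff N a (\<alpha> + \<beta>)" "j \<in># \<alpha>" for \<alpha> j
    proof -
      have v: "hvalid N (\<alpha> + \<beta>)" using that(2) by (simp add: hcoeff_def split: if_splits)
      have eq: "{i. Some i \<in># \<alpha> + \<beta>} = A \<union> {i. Some i \<in># \<alpha>}" by (auto simp: A_def)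
      have "0 < b {i. Some i \<in># \<alpha>}"
        using that(2) v unfolding hcoeff_def eq b_def by (simp add: zero_less_mult_iff)
      moreover have "{i. Some i \<in># \<alpha>} \<subseteq> R"
        using hvalid_add[OF v] by (auto simp: R_def A_def hvalid_def)
      moreover have size: "Suc d = count \<alpha> None + card {i. Some i \<in># \<alpha>}"
        using size_hvalid[OF fin hvalid_add(1)[OF v]] that(1) by simp
      moreover have "j \<in> avail (Suc d) {i. Some i \<in># \<alpha>}"
      proof (cases j)
        case None
        then have "0 < count \<alpha> None" using that(3) by simp
        then show ?thesis using None size by (simp add: avail_def)
      qed (use that(3) in \<open>simp add: avail_def\<close>)
      ultimately show ?thesis by simp
    qed
    show "z j = z k"
    proof (rule exp_M_natural_connected[OF finR b, where S = "{i. Some i \<in># \<alpha>}"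
          and T = "{i. Some i \<in># \<alpha>'}" and D = "Suc d"])
      fix S j k
      assume S: "S \<subseteq> R" "card S \<le> Suc d" "0 < b S" "j \<in> avail (Suc d) S" "k \<in> avail (Suc d) S"
      \<comment> \<open>The monomial of degree \<open>Suc d\<close> that belongs to
        \<open>S\<close>: the missing degree is filled with \<open>y\<close>.\<close>
      define \<gamma> where "\<gamma> = mset_set (Some ` S) + replicate_mset (Suc d - card S) None"
      have finS: "finite S" using S(1) finR finite_subset by blast
      have mem: "i \<in># \<gamma>" if "i \<in> avail (Suc d) S" for i
        using that finS by (auto simp: avail_def \<gamma>_def split: if_splits)
      have "size \<gamma> = Suc d"
        using S(2) finS by (simp add: \<gamma>_def card_image)
      moreover have "set_mset \<gamma> \<subseteq> ?I"
        using S(1) finS by (auto simp: \<gamma>_def R_def split: if_splits)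
      moreover have "0 < hcoeff N a (\<gamma> + \<beta>)"
      proof -
        have "hvalid N (\<gamma> + \<beta>)"
          unfolding \<gamma>_def using S(1) finS \<beta> by (intro hvalid_mset_set) (auto simp: R_def A_def)
        moreover have "{i. Some i \<in># \<gamma> + \<beta>} = A \<union> S"
          using finS by (auto simp: A_def \<gamma>_def split: if_splits)
        ultimately show ?thesis using S(3) unfolding hcoeff_def b_def by simp
      qed
      ultimately show "z j = z k" using mem S by (intro z[of \<gamma>]) auto
    qed (use supp[OF \<alpha>] supp[OF \<alpha>'] Suc.hyps in auto)
  qed (use fin a Suc.hyps in \<open>auto intro: hcoeff_nonneg\<close>)
qed

section \<open>Evaluation of iterated directional derivatives\<close>

lemma foldr_ddir_commute: "ddir I v (foldr (ddir I) vs c) = foldr (ddir I) vs (ddir I v c)"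
  by (induction vs) (simp_all add: ddir_commute)

text \<open>The one property of \<open>hcoeff\<close> that the evaluations need; unlike the formula
  for \<open>hcoeff\<close> it is inherited by derivatives.\<close>

definition vanishing :: "'n set \<Rightarrow> ('n option multiset \<Rightarrow> real) \<Rightarrow> bool" where
  "vanishing N c \<longleftrightarrow> (\<forall>\<alpha>. \<not> hvalid N \<alpha> \<longrightarrow> c \<alpha> = 0)"

lemma vanishing_ddir:
  assumes "vanishing N c"
  shows "vanishing N (ddir I v c)"
  unfolding vanishing_def
proof (intro allI impI)
  fix \<alpha> assume "\<not> hvalid N \<alpha>"
  then have "c (add_mset i \<alpha>) = 0" for i
    using assms by (cases i) (simp_all add: vanishing_def)
  then show "ddir I v c \<alpha> = 0" by (simp add: ddir_def)
qed

lemma vanishing_foldr_ddir: "vanishing N c \<Longrightarrow> vanishing N (foldr (ddir I) vs c)"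
  by (induction vs) (simp_all add: vanishing_ddir)

lemma ddir_indicator:
  assumes "finite N" "X \<subseteq> N" "finite Z" "vanishing N c"
  shows "ddir (insert None (Some ` N)) (indicator (Some ` X)) c (mset_set (Some ` Z)) =
    (\<Sum>x\<in>X - Z. c (mset_set (Some ` insert x Z)))"
proof -
  let ?m = "mset_set (Some ` Z)"
  have "ddir (insert None (Some ` N)) (indicator (Some ` X)) c ?m
      = (\<Sum>i\<in>Some ` X. indicator (Some ` X) i * c (add_mset i ?m))"
    unfolding ddir_def using assms by (intro sum.mono_neutral_right) (auto simp: indicator_def)
  also have "\<dots> = (\<Sum>x\<in>X. c (add_mset (Some x) ?m))"
    by (simp add: sum.reindex)
  also have "\<dots> = (\<Sum>x\<in>X - Z. c (add_mset (Some x) ?m))"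
  proof (rule sum.mono_neutral_right)
    show "\<forall>x\<in>X - (X - Z). c (add_mset (Some x) ?m) = 0"
      using assms(3,4) by (auto simp: vanishing_def)
  qed (use assms finite_subset in auto)
  also have "\<dots> = (\<Sum>x\<in>X - Z. c (mset_set (Some ` insert x Z)))"
    using assms(3) by (intro sum.cong refl) (simp add: image_iff)
  finally show ?thesis .
qed

text \<open>Double counting of pairs \<open>x \<in> W\<close>: each \<open>W\<close> of size
  \<open>Suc m\<close> arises once from each of its elements.\<close>

lemma sum_insert_subsets_card:
  fixes h :: "'a set \<Rightarrow> real"
  assumes "finite U"
  shows "(\<Sum>x\<in>U. \<Sum>W | W \<subseteq> U - {x} \<and> card W = m. h (insert x W)) =
    real (Suc m) * (\<Sum>W | W \<subseteq> U \<and> card W = Suc m. h W)"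
proof -
  have fin: "finite {W. W \<subseteq> X \<and> card W = k}" if "X \<subseteq> U" for X k
    using finite_subset[OF that assms] by (simp add: finite_subset[of _ "Pow X"] subset_iff)
  have "(\<Sum>x\<in>U. \<Sum>W | W \<subseteq> U - {x} \<and> card W = m. h (insert x W)) =
      (\<Sum>(x, W)\<in>(SIGMA x:U. {W. W \<subseteq> U - {x} \<and> card W = m}). h (insert x W))"
    using assms fin by (subst sum.Sigma) auto
  also have "\<dots> = (\<Sum>(W, x)\<in>(SIGMA W:{W. W \<subseteq> U \<and> card W = Suc m}. W). h W)"
  proof (rule sum.reindex_bij_witness[where i = "\<lambda>(W, x). (x, W - {x})" and j = "\<lambda>(x, W). (insert x W, x)"])
    fix p assume "p \<in> (SIGMA x:U. {W. W \<subseteq> U - {x} \<and> card W = m})"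
    then obtain x W where p: "p = (x, W)" "x \<in> U" "W \<subseteq> U - {x}" "card W = m" by auto
    then have "finite W" "x \<notin> W" using assms finite_subset by auto
    then show "(case case p of (x, W) \<Rightarrow> (insert x W, x) of (W, x) \<Rightarrow> (x, W - {x})) = p"
      "(case p of (x, W) \<Rightarrow> (insert x W, x)) \<in> (SIGMA W:{W. W \<subseteq> U \<and> card W = Suc m}. W)"
      "(case case p of (x, W) \<Rightarrow> (insert x W, x) of (W, x) \<Rightarrow> h W) = (case p of (x, W) \<Rightarrow> h (insert x W))"
      using p by auto
  next
    fix p assume "p \<in> (SIGMA W:{W. W \<subseteq> U \<and> card W = Suc m}. W)"
    then obtain x W where p: "p = (W, x)" "x \<in> W" "W \<subseteq> U" "card W = Suc m" by auto
    then have "finite W" using assms finite_subset by auto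
    then show "(case case p of (W, x) \<Rightarrow> (x, W - {x}) of (x, W) \<Rightarrow> (insert x W, x)) = p"
      "(case p of (W, x) \<Rightarrow> (x, W - {x})) \<in> (SIGMA x:U. {W. W \<subseteq> U - {x} \<and> card W = m})"
      using p by (auto simp: insert_absorb)
  qed
  also have "\<dots> = (\<Sum>W | W \<subseteq> U \<and> card W = Suc m. \<Sum>x\<in>W. h W)"
    using fin[of U] finite_subset[OF _ assms] by (subst sum.Sigma) auto
  also have "\<dots> = real (Suc m) * (\<Sum>W | W \<subseteq> U \<and> card W = Suc m. h W)"
    by (simp add: sum_distrib_left)
  finally show ?thesis .
qed

text \<open>The direction is the sum of the \<open>w x\<close> derivatives over \<open>X\<close>.
  Repeated variables give zero, and each set \<open>W\<close> is reached in \<open>m!\<close>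
  orders.\<close>

lemma foldr_ddir_replicate_indicator:
  assumes fin: "finite N" and "X \<subseteq> N" and c: "vanishing N c" and "finite Z"
  shows "foldr (ddir (insert None (Some ` N))) (replicate m (indicator (Some ` X))) c (mset_set (Some ` Z)) =
    fact m * (\<Sum>W | W \<subseteq> X - Z \<and> card W = m. c (mset_set (Some ` (Z \<union> W))))"
  using \<open>finite Z\<close>
proof (induction m arbitrary: Z)
  case 0
  have "finite X" using assms finite_subset by blast
  then have "{W. W \<subseteq> X - Z \<and> card W = 0} = {{}}"
    using finite_subset[of _ "X - Z"] by (auto simp: card_eq_0_iff)
  then show ?case by simp
next
  case (Suc m)
  let ?D = "ddir (insert None (Some ` N))" and ?v = "indicator (Some ` X)"
  have finX: "finite (X - Z)" using assms finite_subset by blast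
  have "foldr ?D (replicate (Suc m) ?v) c (mset_set (Some ` Z)) =
      (\<Sum>x\<in>X - Z. foldr ?D (replicate m ?v) c (mset_set (Some ` insert x Z)))"
    unfolding replicate_Suc foldr.simps o_apply
    by (rule ddir_indicator[OF fin assms(2) Suc.prems vanishing_foldr_ddir[OF c]])
  also have "\<dots> = (\<Sum>x\<in>X - Z. fact m * (\<Sum>W | W \<subseteq> X - Z - {x} \<and> card W = m.
      c (mset_set (Some ` (Z \<union> insert x W)))))"
  proof (intro sum.cong refl)
    fix x
    have "X - insert x Z = X - Z - {x}" "insert x Z \<union> W = Z \<union> insert x W" for W by auto
    then show "foldr ?D (replicate m ?v) c (mset_set (Some ` insert x Z)) =
        fact m * (\<Sum>W | W \<subseteq> X - Z - {x} \<and> card W = m. c (mset_set (Some ` (Z \<union> insert x W))))"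
      using Suc.IH[of "insert x Z"] Suc.prems by simp
  qed
  also have "\<dots> = fact m * (\<Sum>x\<in>X - Z. \<Sum>W | W \<subseteq> X - Z - {x} \<and> card W = m.
      c (mset_set (Some ` (Z \<union> insert x W))))"
    by (rule sum_distrib_left[symmetric])
  also have "\<dots> = fact (Suc m) * (\<Sum>W | W \<subseteq> X - Z \<and> card W = Suc m. c (mset_set (Some ` (Z \<union> W))))"
    using sum_insert_subsets_card[OF finX, where h = "\<lambda>W. c (mset_set (Some ` (Z \<union> W)))"]
    by (simp add: mult_ac)
  finally show ?case .
qed

lemma foldr_ddir_replicate_None:
  "foldr (ddir (insert None (Some ` N))) (replicate p (indicator {None})) c \<alpha> = c (replicate_mset p None + \<alpha>)"
  if "finite N"
proof (induction p arbitrary: \<alpha>)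
  case (Suc p)
  let ?F = "\<lambda>p. foldr (ddir (insert None (Some ` N))) (replicate p (indicator {None})) c"
  have "?F (Suc p) \<alpha> = (\<Sum>i\<in>insert None (Some ` N). indicator {None} i * ?F p (add_mset i \<alpha>))"
    unfolding replicate_Suc by (rule foldr_ddir_Cons)
  also have "\<dots> = (\<Sum>i\<in>{None}. indicator {None} i * ?F p (add_mset i \<alpha>))"
    using that by (intro sum.mono_neutral_right) (auto simp: indicator_def)
  also have "\<dots> = c (replicate_mset p None + add_mset None \<alpha>)"
    unfolding Suc.IH by simp
  finally show ?case by simp
qed simp

text \<open>Each direction picks one of the two copies of its \<open>e\<close>; \<open>A\<close>
  collects the elements whose left copy is picked, so the right copies form the complement of
  \<open>A\<close>.\<close>

lemma foldr_ddir_pairs: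
  fixes c :: "('a + 'a) option multiset \<Rightarrow> real"
  assumes N: "N = Inl ` E \<union> Inr ` E" and fin: "finite E" and c: "vanishing N c"
    and "distinct es" "set es \<subseteq> E" "finite Z" "Z \<inter> (Inl ` set es \<union> Inr ` set es) = {}"
  shows "foldr (ddir (insert None (Some ` N))) (map (\<lambda>e. indicator (Some ` {Inl e, Inr e})) es) c (mset_set (Some ` Z)) =
    (\<Sum>A\<in>Pow (set es). c (mset_set (Some ` (Z \<union> (Inl ` A \<union> Inr ` (set es - A))))))"
  using assms(4-)
proof (induction es arbitrary: Z)
  case (Cons e es)
  let ?D = "ddir (insert None (Some ` N))"
  let ?F = "foldr ?D (map (\<lambda>e. indicator (Some ` {Inl e, Inr e})) es) c"
  let ?h = "\<lambda>Z. c (mset_set (Some ` Z))"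
  have finN: "finite N" "{Inl e, Inr e} \<subseteq> N" using N fin Cons.prems by auto
  have e: "e \<notin> set es" "Inl e \<notin> Z" "Inr e \<notin> Z" using Cons.prems by auto
  have "foldr ?D (map (\<lambda>e. indicator (Some ` {Inl e, Inr e})) (e # es)) c (mset_set (Some ` Z))
      = (\<Sum>x\<in>{Inl e, Inr e} - Z. ?F (mset_set (Some ` insert x Z)))"
    using ddir_indicator[OF finN Cons.prems(3) vanishing_foldr_ddir[OF c]] by simp
  also have "{Inl e, Inr e} - Z = {Inl e, Inr e}" using e by auto
  also have "(\<Sum>x\<in>{Inl e, Inr e}. ?F (mset_set (Some ` insert x Z))) =
      ?F (mset_set (Some ` insert (Inl e) Z)) + ?F (mset_set (Some ` insert (Inr e) Z))"
    by simp
  also have "?F (mset_set (Some ` insert (Inl e) Z)) =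
      (\<Sum>A\<in>Pow (set es). ?h (insert (Inl e) Z \<union> (Inl ` A \<union> Inr ` (set es - A))))"
    using Cons.prems e by (intro Cons.IH) auto
  also have "\<dots> = (\<Sum>A\<in>Pow (set es). ?h (Z \<union> (Inl ` insert e A \<union> Inr ` (set (e # es) - insert e A))))"
    using e by (intro sum.cong refl arg_cong[where f = ?h]) auto
  also have "?F (mset_set (Some ` insert (Inr e) Z)) =
      (\<Sum>A\<in>Pow (set es). ?h (insert (Inr e) Z \<union> (Inl ` A \<union> Inr ` (set es - A))))"
    using Cons.prems e by (intro Cons.IH) auto
  also have "\<dots> = (\<Sum>A\<in>Pow (set es). ?h (Z \<union> (Inl ` A \<union> Inr ` (set (e # es) - A))))"
    using e by (intro sum.cong refl arg_cong[where f = ?h]) auto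
  also have "(\<Sum>A\<in>Pow (set es). ?h (Z \<union> (Inl ` insert e A \<union> Inr ` (set (e # es) - insert e A))))
      + (\<Sum>A\<in>Pow (set es). ?h (Z \<union> (Inl ` A \<union> Inr ` (set (e # es) - A))))
      = (\<Sum>A\<in>Pow (set (e # es)). ?h (Z \<union> (Inl ` A \<union> Inr ` (set (e # es) - A))))"
  proof -
    have inj: "inj_on (insert e) (Pow (set es))"
      using e by (auto simp: inj_on_def insert_eq_iff)
    have disj: "Pow (set es) \<inter> insert e ` Pow (set es) = {}" using e by auto
    have "Pow (set (e # es)) = Pow (set es) \<union> insert e ` Pow (set es)"
      by (simp add: Pow_insert)
    then show ?thesis
      using disj by (simp only:) (subst sum.union_disjoint, auto simp: sum.reindex[OF inj])
  qed
  finally show ?case .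
qed simp

text \<open>A direct sum of \<open>a2\<close> and the dual of \<open>a1\<close>. Complements reverse
  the roles: a right copy in \<open>S\<close> but not in \<open>T\<close> is an element of the
  complement of \<open>T\<close> alone, so \<open>a1\<close> is exchanged from \<open>T\<close> to
  \<open>S\<close>.\<close>

lemma exp_M_natural_pair:
  assumes a1: "exp_M_natural E a1" and a2: "exp_M_natural E a2"
  shows "exp_M_natural (Inl ` E \<union> Inr ` E) (\<lambda>Z. a2 (Inl -` Z) * a1 (E - Inr -` Z))"
  unfolding exp_M_natural_def
proof (intro conjI allI impI ballI)
  let ?N = "Inl ` E \<union> Inr ` E" and ?a = "\<lambda>Z. a2 (Inl -` Z) * a1 (E - Inr -` Z)"
  show "0 \<le> ?a S" if "S \<subseteq> ?N" for S
    using that by (intro mult_nonneg_nonneg exp_M_natural_nonneg[OF a1] exp_M_natural_nonneg[OF a2]) auto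
  fix S T i assume *: "S \<subseteq> ?N" "T \<subseteq> ?N" "i \<in> S - T"
  have sub: "Inl -` S \<subseteq> E" "Inl -` T \<subseteq> E" "E - Inr -` S \<subseteq> E" "E - Inr -` T \<subseteq> E" using * by auto
  have nn1: "0 \<le> a1 (E - Inr -` S) * a1 (E - Inr -` T)"
    using sub by (intro mult_nonneg_nonneg exp_M_natural_nonneg[OF a1]) auto
  have nn2: "0 \<le> a2 (Inl -` S) * a2 (Inl -` T)"
    using sub by (intro mult_nonneg_nonneg exp_M_natural_nonneg[OF a2]) auto
  show "?a S * ?a T \<le> ?a (S - {i}) * ?a (insert i T) \<or>
      (\<exists>j\<in>T - S. ?a S * ?a T \<le> ?a (insert j (S - {i})) * ?a (insert i (T - {j})))"
  proof (cases i)
    case (Inl e)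
    have e: "e \<in> Inl -` S" "e \<notin> Inl -` T" using * Inl by auto
    from exp_M_natural_exchange[OF a2 sub(1,2) e] show ?thesis
    proof cases
      case 1
      have eq: "Inl -` (S - {i}) = Inl -` S - {e}" "Inr -` (S - {i}) = Inr -` S"
        "Inl -` insert i T = insert e (Inl -` T)" "Inr -` insert i T = Inr -` T" using Inl by auto
      show ?thesis
        unfolding eq using mult_right_mono[OF 1 nn1] by (simp add: mult_ac)
    next
      case (2 f)
      have eq: "Inl -` (insert (Inl f) (S - {i})) = insert f (Inl -` S - {e})"
        "Inr -` (insert (Inl f) (S - {i})) = Inr -` S"
        "Inl -` insert i (T - {Inl f}) = insert e (Inl -` T - {f})"
        "Inr -` insert i (T - {Inl f}) = Inr -` T" using Inl by auto
      have "?a S * ?a T \<le> ?a (insert (Inl f) (S - {i})) * ?a (insert i (T - {Inl f}))"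
        unfolding eq using mult_right_mono[OF 2(3) nn1] by (simp add: mult_ac)
      then show ?thesis using 2 by blast
    qed
  next
    case (Inr e)
    have e: "e \<in> E - Inr -` T" "e \<notin> E - Inr -` S" using * Inr by auto
    from exp_M_natural_exchange[OF a1 sub(4,3) e] show ?thesis
    proof cases
      case 1
      have eq: "E - Inr -` (S - {i}) = insert e (E - Inr -` S)" "Inl -` (S - {i}) = Inl -` S"
        "E - Inr -` insert i T = E - Inr -` T - {e}" "Inl -` insert i T = Inl -` T"
        using Inr * by auto
      show ?thesis
        unfolding eq using mult_left_mono[OF 1 nn2] by (simp add: mult_ac)
    next
      case (2 f)
      have eq: "E - Inr -` (insert (Inr f) (S - {i})) = insert e (E - Inr -` S - {f})"
        "Inl -` (insert (Inr f) (S - {i})) = Inl -` S"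
        "E - Inr -` insert i (T - {Inr f}) = insert f (E - Inr -` T - {e})"
        "Inl -` insert i (T - {Inr f}) = Inl -` T" using Inr * 2 e by auto
      have "?a S * ?a T \<le> ?a (insert (Inr f) (S - {i})) * ?a (insert i (T - {Inr f}))"
        unfolding eq using mult_left_mono[OF 2(3) nn2] by (simp add: mult_ac)
      moreover have "Inr f \<in> T - S" using 2 by auto
      ultimately show ?thesis by blast
    qed
  qed
qed

section \<open>Log-concavity\<close>

definition q_value :: "real \<Rightarrow> ereal \<Rightarrow> real" where
  "q_value q x = (if x = -\<infinity> then 0 else q powr (- real_of_ereal x))"

lemma q_weight_eq: "0 < q \<Longrightarrow> q_weight q x y = q_value q x * q_value q y"
  by (simp add: q_weight_def q_value_def powr_add[symmetric])

lemma q_value_mult_mono: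
  assumes "0 < q" "q \<le> 1" "x \<noteq> \<infinity>" "y \<noteq> \<infinity>" "x' \<noteq> \<infinity>" "y' \<noteq> \<infinity>" "x + y \<le> x' + y'"
  shows "q_value q x * q_value q y \<le> q_value q x' * q_value q y'"
proof (cases "x = -\<infinity> \<or> y = -\<infinity>")
  case True
  then show ?thesis by (auto simp: q_value_def)
next
  case False
  then obtain r s where rs: "x = ereal r" "y = ereal s"
    using assms(3,4) by (cases x; cases y) auto
  obtain r' s' where rs': "x' = ereal r'" "y' = ereal s'"
    using assms(5-7) rs by (cases x'; cases y') auto
  have "q powr (- r - s) \<le> q powr (- r' - s')"
    using assms(1,2,7) rs rs' by (intro powr_mono') auto
  then show ?thesis
    by (simp add: rs rs' q_value_def powr_add[symmetric])
qed

lemma exp_M_natural_q_value: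
  assumes "M_natural_concave E \<nu>" "0 < q" "q \<le> 1"
  shows "exp_M_natural E (\<lambda>S. q_value q (\<nu> S))"
  unfolding exp_M_natural_def
proof (intro conjI allI impI ballI)
  fix S T i assume *: "S \<subseteq> E" "T \<subseteq> E" "i \<in> S - T"
  have fin: "\<nu> X \<noteq> \<infinity>" if "X \<subseteq> E" for X
    using assms(1) that by (simp add: M_natural_concave_def)
  have "\<nu> S + \<nu> T \<le> \<nu> (S - {i}) + \<nu> (T \<union> {i}) \<or>
      (\<exists>j\<in>T - S. \<nu> S + \<nu> T \<le> \<nu> ((S - {i}) \<union> {j}) + \<nu> ((T - {j}) \<union> {i}))"
    using assms(1)[unfolded M_natural_concave_def, THEN conjunct2] * by simp
  then show "q_value q (\<nu> S) * q_value q (\<nu> T) \<le> q_value q (\<nu> (S - {i})) * q_value q (\<nu> (insert i T)) \<or>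
      (\<exists>j\<in>T - S. q_value q (\<nu> S) * q_value q (\<nu> T)
        \<le> q_value q (\<nu> (insert j (S - {i}))) * q_value q (\<nu> (insert i (T - {j}))))"
  proof (elim disjE bexE)
    assume "\<nu> S + \<nu> T \<le> \<nu> (S - {i}) + \<nu> (T \<union> {i})"
    then show ?thesis
      using * by (intro disjI1 q_value_mult_mono assms(2,3) fin) auto
  next
    fix j assume j: "j \<in> T - S" "\<nu> S + \<nu> T \<le> \<nu> ((S - {i}) \<union> {j}) + \<nu> ((T - {j}) \<union> {i})"
    then show ?thesis
      using * by (intro disjI2 bexI[of _ j] q_value_mult_mono assms(2,3) fin) auto
  qed
qed (simp add: q_value_def)

lemma J_eq:
  assumes fin: "finite E" and q: "0 < q"
  shows "J E \<nu>1 \<nu>2 q m =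
    (\<Sum>A\<in>Pow E. \<Sum>D | D \<subseteq> E - A \<and> card D = m. q_value q (\<nu>1 A) * q_value q (\<nu>2 (A \<union> D)))"
proof -
  have "J E \<nu>1 \<nu>2 q m = (\<Sum>(A, D)\<in>(SIGMA A:Pow E. {D. D \<subseteq> E - A \<and> card D = m}).
      q_value q (\<nu>1 A) * q_value q (\<nu>2 (A \<union> D)))"
    unfolding J_def
    by (rule sum.reindex_bij_witness[where i = "\<lambda>(A, D). (A, A \<union> D)" and j = "\<lambda>(S1, S2). (S1, S2 - S1)"])
      (auto simp: q_weight_eq[OF q] Un_absorb1 Un_Diff Diff_triv dest: subsetD intro!: arg_cong[where f = card])
  also have "\<dots> = (\<Sum>A\<in>Pow E. \<Sum>D | D \<subseteq> E - A \<and> card D = m. q_value q (\<nu>1 A) * q_value q (\<nu>2 (A \<union> D)))"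
  proof (rule sum.Sigma[symmetric])
    show "\<forall>A\<in>Pow E. finite {D. D \<subseteq> E - A \<and> card D = m}"
      using fin by (auto intro!: finite_subset[of _ "Pow E"])
  qed (use fin in simp)
  finally show ?thesis .
qed

text \<open>Evaluating the Hessian at two directions is differentiating twice more, so the
  Lorentzian inequality compares complete derivatives, which are numbers.\<close>

lemma bil_foldr_ddir: "bil I (\<lambda>i j. foldr (ddir I) vs c {#i, j#}) x z = foldr (ddir I) (x # z # vs) c {#}"
proof -
  have "bil I (\<lambda>i j. foldr (ddir I) vs c {#i, j#}) x z =
      (\<Sum>i\<in>I. x i * (\<Sum>j\<in>I. foldr (ddir I) vs c {#i, j#} * z j))"
    by (rule bil_row)
  also have "\<dots> = foldr (ddir I) (x # z # vs) c {#}"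
    unfolding foldr_ddir_Cons by (simp add: mult.commute add_mset_commute)
  finally show ?thesis .
qed

context
  fixes E :: "'a set" and a1 a2 :: "'a set \<Rightarrow> real"
  assumes fin: "finite E" and a1: "exp_M_natural E a1" and a2: "exp_M_natural E a2"
begin

private abbreviation "N \<equiv> Inl ` E \<union> Inr ` E :: ('a + 'a) set"
private abbreviation "P \<equiv> hcoeff N (\<lambda>Z. a2 (Inl -` Z) * a1 (E - Inr -` Z))"
private abbreviation "D \<equiv> ddir (insert None (Some ` N))"
private abbreviation "d_w \<equiv> indicator (Some ` Inl ` E) :: ('a + 'a) option \<Rightarrow> real"
private abbreviation "d_y \<equiv> indicator {None} :: ('a + 'a) option \<Rightarrow> real"
private abbreviation "d_u e \<equiv> indicator (Some ` {Inl e, Inr e}) :: ('a + 'a) option \<Rightarrow> real"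

text \<open>For \<open>m + p = card E\<close> this is the derivative of full order
  \<open>card N\<close>: \<open>m! p!\<close> times the coefficient of x^m y^p in the binary form
  obtained from \<open>P\<close>.\<close>

lemma directional_derivative_eq:
  assumes es: "distinct es" "set es = E"
  shows "foldr D (map d_u es) (foldr D (replicate m d_w) (foldr D (replicate p d_y) P)) {#} =
    fact m * fact p * (\<Sum>A\<in>Pow E. \<Sum>B | B \<subseteq> E - A \<and> card B = m. a1 A * a2 (A \<union> B))"
proof -
  have finN: "finite N" using fin by simp
  have van: "vanishing N P" by (simp add: vanishing_def hcoeff_def)
  let ?P = "foldr D (replicate p d_y) P"
  have val: "?P (mset_set (Some ` Z)) = fact p * (a2 (Inl -` Z) * a1 (E - Inr -` Z))" if "Z \<subseteq> N" for Z
  proof -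
    have finZ: "finite Z" using that finN finite_subset by blast
    have "hvalid N (mset_set (Some ` Z) + replicate_mset p None + {#})"
      using finZ that by (intro hvalid_mset_set) (auto simp: hvalid_def)
    moreover have "count (replicate_mset p None + mset_set (Some ` Z)) None = p"
      using finZ by (simp add: count_mset_set')
    moreover have "{i. Some i \<in># replicate_mset p None + mset_set (Some ` Z)} = Z"
      using finZ by (auto split: if_splits)
    ultimately show ?thesis
      unfolding foldr_ddir_replicate_None[OF finN] hcoeff_def by (simp add: add.commute)
  qed
  have "foldr D (map d_u es) (foldr D (replicate m d_w) ?P) (mset_set (Some ` {})) =
      (\<Sum>A\<in>Pow (set es). foldr D (replicate m d_w) ?P (mset_set (Some ` ({} \<union> (Inl ` A \<union> Inr ` (set es - A))))))"
    using es by (intro foldr_ddir_pairs[OF refl fin] vanishing_foldr_ddir van) auto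
  also have "\<dots> = (\<Sum>A\<in>Pow E. fact m * fact p * (\<Sum>B | B \<subseteq> E - A \<and> card B = m. a1 A * a2 (A \<union> B)))"
    unfolding es(2)
  proof (intro sum.cong refl)
    fix A assume A: "A \<in> Pow E"
    let ?Z = "{} \<union> (Inl ` A \<union> Inr ` (E - A)) :: ('a + 'a) set"
    have "foldr D (replicate m d_w) ?P (mset_set (Some ` ?Z)) =
        fact m * (\<Sum>W | W \<subseteq> Inl ` E - ?Z \<and> card W = m. ?P (mset_set (Some ` (?Z \<union> W))))"
      using A fin finite_subset
      by (intro foldr_ddir_replicate_indicator[OF finN] vanishing_foldr_ddir van) auto
    also have "(\<Sum>W | W \<subseteq> Inl ` E - ?Z \<and> card W = m. ?P (mset_set (Some ` (?Z \<union> W)))) =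
        (\<Sum>B | B \<subseteq> E - A \<and> card B = m. fact p * (a1 A * a2 (A \<union> B)))"
    proof (rule sum.reindex_bij_witness[where i = "\<lambda>B. Inl ` B" and j = "\<lambda>W. Inl -` W"])
      fix W :: "('a + 'a) set" assume "W \<in> {W. W \<subseteq> Inl ` E - ?Z \<and> card W = m}"
      then have W: "W \<subseteq> Inl ` E - ?Z" "card W = m" by auto
      show W': "Inl ` Inl -` W = W" using W by auto
      then have "card (Inl -` W) = card W" by (metis card_image inj_Inl inj_on_subset subset_UNIV)
      then show "Inl -` W \<in> {B. B \<subseteq> E - A \<and> card B = m}" using W by auto
      \<comment> \<open>\<open>W\<close> adds left copies only, so it enlarges the argument of
        \<open>a2\<close> from \<open>A\<close> to the larger set of the pair and leaves that of
        \<open>a1\<close> at \<open>A\<close>.\<close>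
      have "Inl -` (?Z \<union> W) = A \<union> Inl -` W" "E - Inr -` (?Z \<union> W) = A" using W A by auto
      moreover have "?Z \<union> W \<subseteq> N" using W A by auto
      ultimately show "fact p * (a1 A * a2 (A \<union> Inl -` W)) = ?P (mset_set (Some ` (?Z \<union> W)))"
        by (simp only: val mult_ac)
    next
      fix B assume "B \<in> {B. B \<subseteq> E - A \<and> card B = m}"
      then show "Inl -` Inl ` B = B" "Inl ` B \<in> {W. W \<subseteq> Inl ` E - ?Z \<and> card W = m}"
        by (auto simp: card_image)
    qed
    finally show "foldr D (replicate m d_w) ?P (mset_set (Some ` ?Z)) =
        fact m * fact p * (\<Sum>B | B \<subseteq> E - A \<and> card B = m. a1 A * a2 (A \<union> B))"
      by (simp add: sum_distrib_left mult_ac)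
  qed
  finally show ?thesis by (simp add: sum_distrib_left)
qed

lemma ultra_log_concave:
  fixes F :: "nat \<Rightarrow> real"
  assumes F: "\<And>m. F m = (\<Sum>A\<in>Pow E. \<Sum>B | B \<subseteq> E - A \<and> card B = m. a1 A * a2 (A \<union> B))"
    and k: "k + p + 2 = card E"
  shows "(fact (k + 2) * fact p * F (k + 2)) * (fact k * fact (p + 2) * F k) \<le>
    (fact (k + 1) * fact (p + 1) * F (k + 1))\<^sup>2"
proof -
  obtain es where es: "distinct es" "set es = E" using finite_distinct_list[OF fin] by blast
  have len: "length es = card E" using distinct_card[OF es(1)] es(2) by simp
  have finN: "finite N" using fin by simp
  have cN: "card N = 2 * card E"
    using fin by (subst card_Un_disjoint) (auto simp: card_image)
  let ?\<Psi> = "\<lambda>m p. foldr D (map d_u es) (foldr D (replicate m d_w) (foldr D (replicate p d_y) P)) {#}"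
  \<comment> \<open>\<open>card E + k + p = card N - 2\<close> directions, which leaves a quadratic
    form; its values at \<open>d_w\<close> and \<open>d_y\<close> are the derivatives with
    \<open>k + 2\<close>, \<open>k + 1\<close> and \<open>k\<close> directions
    \<open>d_w\<close>.\<close>
  define vs where "vs = map d_u es @ replicate k d_w @ replicate p d_y"
  have fold: "foldr D vs P = foldr D (map d_u es) (foldr D (replicate k d_w) (foldr D (replicate p d_y) P))"
    by (simp add: vs_def)
  have w: "D d_w (foldr D (map d_u es) (foldr D (replicate m d_w) c)) =
      foldr D (map d_u es) (foldr D (replicate (Suc m) d_w) c)" for m c
    by (simp only: foldr_ddir_commute[of _ d_w "map d_u es"] replicate_Suc foldr.simps o_apply)
  have y: "D d_y (foldr D (map d_u es) (foldr D ws (foldr D (replicate m d_y) c))) =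
      foldr D (map d_u es) (foldr D ws (foldr D (replicate (Suc m) d_y) c))" for m ws c
    by (simp only: foldr_ddir_commute[of _ d_y] replicate_Suc foldr.simps o_apply)
  let ?M = "\<lambda>i j. foldr D vs P {#i, j#}"
  have ww: "bil (insert None (Some ` N)) ?M d_w d_w = ?\<Psi> (Suc (Suc k)) p"
    unfolding bil_foldr_ddir foldr.simps o_apply fold w ..
  have yy: "bil (insert None (Some ` N)) ?M d_y d_y = ?\<Psi> k (Suc (Suc p))"
    unfolding bil_foldr_ddir foldr.simps o_apply fold y ..
  have wy: "bil (insert None (Some ` N)) ?M d_w d_y = ?\<Psi> (Suc k) (Suc p)"
    unfolding bil_foldr_ddir foldr.simps o_apply fold y w ..
  have "lorentzian (insert None (Some ` N)) (card N) (\<lambda>\<alpha>. P (\<alpha> + {#}))"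
    using k cN by (intro lorentzian_hcoeff finN exp_M_natural_pair a1 a2) auto
  moreover have "length vs + 2 = card N" using cN k len by (simp add: vs_def)
  moreover have "\<forall>v\<in>set vs. \<forall>i\<in>insert None (Some ` N). 0 \<le> v i"
    by (auto simp: vs_def)
  ultimately have "lorentz_form (insert None (Some ` N)) ?M"
    unfolding lorentzian_def by simp
  then have "?\<Psi> (Suc (Suc k)) p * ?\<Psi> k (Suc (Suc p)) \<le> (?\<Psi> (Suc k) (Suc p))\<^sup>2"
    unfolding lorentz_form_def ww[symmetric] yy[symmetric] wy[symmetric] by simp
  then show ?thesis
    unfolding directional_derivative_eq[OF es] F[symmetric] by (simp add: mult_ac)
qed

end

text \<open>Trades the factorials of the derivatives for binomials; \<open>fact n\<close> then
  cancels from both sides of the claim.\<close>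

lemma divide_binomial_eq:
  "m + p = n \<Longrightarrow> x / real (n choose m) = fact m * fact p * x / fact n"
  using binomial_fact[of m n, where 'a = real] by auto

theorem theorem2:
  fixes E :: "'a set" and \<nu>1 \<nu>2 :: "'a set \<Rightarrow> ereal" and q :: real and k :: nat
  assumes "finite E"
    and "M_natural_concave E \<nu>1"
    and "M_natural_concave E \<nu>2"
    and "0 < q" and "q \<le> 1"
    and "k + 2 \<le> card E"
  shows "J E \<nu>1 \<nu>2 q k / real (card E choose k)
           * (J E \<nu>1 \<nu>2 q (k + 2) / real (card E choose (k + 2)))
         \<le> (J E \<nu>1 \<nu>2 q (k + 1) / real (card E choose (k + 1)))\<^sup>2"
proof -
  let ?J = "J E \<nu>1 \<nu>2 q" and ?n = "card E"
  obtain p where p: "k + p + 2 = ?n" using assms(6) by (metis add.assoc add.commute le_Suc_ex)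
  note 1 = exp_M_natural_q_value[OF assms(2,4,5)] and 2 = exp_M_natural_q_value[OF assms(3,4,5)]
  have main: "(fact (k + 2) * fact p * ?J (k + 2)) * (fact k * fact (p + 2) * ?J k) \<le>
      (fact (k + 1) * fact (p + 1) * ?J (k + 1))\<^sup>2"
    by (rule ultra_log_concave[OF assms(1) 1 2 J_eq[OF assms(1,4)] p])
  have "?J k / real (?n choose k) * (?J (k + 2) / real (?n choose (k + 2))) =
      (fact (k + 2) * fact p * ?J (k + 2)) * (fact k * fact (p + 2) * ?J k) / (fact ?n)\<^sup>2"
    using p by (subst divide_binomial_eq[of k "p + 2"], simp, subst divide_binomial_eq[of "k + 2" p])
      (simp_all add: power2_eq_square)
  also have "\<dots> \<le> (fact (k + 1) * fact (p + 1) * ?J (k + 1))\<^sup>2 / (fact ?n)\<^sup>2"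
    using main by (intro divide_right_mono) auto
  also have "\<dots> = (?J (k + 1) / real (?n choose (k + 1)))\<^sup>2"
    using p by (subst divide_binomial_eq[of "k + 1" "p + 1"]) (simp_all add: power_divide)
  finally show ?thesis .
qed

end
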